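(* Let $T\in\mathcal{D}'(\mathbb{R}^d)$ be a distribution and $\alpha\in(-\infty,0]$. The following conditions are equivalent. (1) $T$ is in $\mathcal{C}^\alpha$. (2) There is an integer $r>-\alpha$ such that for every compact $K\subset\mathbb{R}^d$ there is $C_K<\infty$ with $|T(\psi_x^\epsilon)|\le C_K\,\epsilon^\alpha$ for all $x\in K$, $\epsilon\in(0,1]$ and $\psi\in\mathcal{B}_r$. (3) There is a test function $\varphi\in\mathcal{D}$ with $\int\varphi\ne 0$ such that for every compact $K\subset\mathbb{R}^d$ there is $C_K<\infty$ with $|T(\varphi_x^\epsilon)|\le C_K\,\epsilon^\alpha$ for all $x\in K$ and $\epsilon\in\{2^{-k}\}_{k\in\mathbb{N}}$. Moreover, for every compact set $K$, the semi-norm $\|T\|_{\mathcal{C}^\alpha(K)}$ can be estimated using an arbitrary test function $\varphi\in\mathcal{D}$ with $\int\varphi\ne 0$: $$\|T\|_{\mathcal{C}^\alpha(K)}\le\mathfrak{b}_{\varphi,\alpha,r_\alpha,d}\,\sup_{x\in\bar K_2,\ \epsilon\in(0,1]}\frac{|T(\varphi_x^\epsilon)|}{\epsilon^\alpha},$$ where $\mathfrak{b}_{\varphi,\alpha,r,d}$ is the explicit constant given in the context.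
   Context: $\mathbb{N}=\{1,2,\dots\}$. $B(x,R)$ is the closed Euclidean ball in $\mathbb{R}^d$; $\bar K_R:=K+B(0,R)$. $\mathcal{D}$ is the space of $C^\infty$ compactly supported functions $\mathbb{R}^d\to\mathbb{R}$, $\mathcal{D}(K)$ the subspace of those supported in $K$, $\mathcal{D}'$ the space of distributions on $\mathbb{R}^d$. $\|\varphi\|_{C^r}:=\max_{|k|\le r}\|\partial^k\varphi\|_\infty$; $\mathcal{B}_r:=\{\psi\in\mathcal{D}(B(0,1)):\|\psi\|_{C^r}\le 1\}$; $\varphi_x^\lambda(z):=\lambda^{-d}\varphi(\lambda^{-1}(z-x))$. For $\alpha\le 0$, let $r_\alpha$ be the smallest integer $r\in\mathbb{N}$ with $r>-\alpha$. The negative Hölder space $\mathcal{C}^\alpha=\mathcal{C}^\alpha(\mathbb{R}^d)$ is the space of distributions $T\in\mathcal{D}'$ such that, for every compact $K$, there is a finite constant $C_K$ with $|T(\psi_x^\epsilon)|\le C_K\epsilon^\alpha$ for all $x\in K$, $\epsilon\in(0,1]$, $\psi\in\mathcal{B}_{r_\alpha}$. For $T\in\mathcal{D}'$ set $$\|T\|_{\mathcal{C}^\alpha(K)}:=\sup_{x\in K,\ \lambda\in(0,1],\ \psi\in\mathcal{B}_{r_\alpha}}\frac{|T(\psi_x^\lambda)|}{\lambda^\alpha}.$$ Explicit constant: with $R_\varphi$ such that $\varphi$ is supported in $B(0,R_\varphi)$, $$\mathfrak{b}_{\varphi,\alpha,r,d}:=\frac{4^{d-\alpha+1}\,e^4\,2^{-\alpha(r+1)}\,r^2}{1-2^{-\alpha-r}}\;\frac{(1+R_\varphi)^{-\alpha}\,\|\varphi\|_{L^1}}{|\int\varphi|^2}.$$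 *)

theory Defs
  imports "HOL-Analysis.Analysis"
begin

section \<open>Smooth functions and test functions on \<open>\<real>\<^sup>d\<close>, where \<open>d = CARD('n)\<close>\<close>

definition partial_deriv :: "'n \<Rightarrow> (real ^ 'n \<Rightarrow> real) \<Rightarrow> (real ^ 'n \<Rightarrow> real)" where
  "partial_deriv i f = (\<lambda>x. frechet_derivative f (at x) (axis i 1))"

primrec times_cont_diff :: "nat \<Rightarrow> (real ^ 'n \<Rightarrow> real) \<Rightarrow> bool" where
  "times_cont_diff 0 f \<longleftrightarrow> continuous_on UNIV f"
| "times_cont_diff (Suc m) f \<longleftrightarrow>
     (\<forall>x. f differentiable (at x)) \<and> (\<forall>i. times_cont_diff m (partial_deriv i f))"

definition smooth :: "(real ^ 'n \<Rightarrow> real) \<Rightarrow> bool" where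
  "smooth f \<longleftrightarrow> (\<forall>m. times_cont_diff m f)"

definition supp :: "(real ^ 'n \<Rightarrow> real) \<Rightarrow> (real ^ 'n) set" where
  "supp f = closure {x. f x \<noteq> 0}"

definition test_functions :: "(real ^ 'n \<Rightarrow> real) set" where
  "test_functions = {\<phi>. smooth \<phi> \<and> compact (supp \<phi>)}"

definition test_functions_in :: "(real ^ 'n) set \<Rightarrow> (real ^ 'n \<Rightarrow> real) set" where
  "test_functions_in K = {\<phi> \<in> test_functions. supp \<phi> \<subseteq> K}"

text \<open>
  A multi-index is a function \<open>k :: 'n \<Rightarrow> nat\<close>. The type \<open>'n\<close> carries no order, so
  \<open>\<partial>\<^sup>k\<close> takes the coordinate derivatives in the order of an arbitrary fixed
  enumeration of \<open>'n\<close>; on smooth functions the order does not matter.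
\<close>

definition coord_list :: "'n::finite list" where
  "coord_list = (SOME js. distinct js \<and> set js = UNIV)"

definition multi_deriv :: "('n::finite \<Rightarrow> nat) \<Rightarrow> (real ^ 'n \<Rightarrow> real) \<Rightarrow> (real ^ 'n \<Rightarrow> real)" where
  "multi_deriv k f = foldr (\<lambda>i. partial_deriv i ^^ k i) coord_list f"

text \<open>
  The real-valued supremum below is the genuine one for bounded functions; it is only ever
  applied to derivatives of test functions.
\<close>

definition sup_norm :: "(real ^ 'n \<Rightarrow> real) \<Rightarrow> real" where
  "sup_norm f = (SUP x. \<bar>f x\<bar>)"

definition Cr_norm :: "nat \<Rightarrow> (real ^ 'n::finite \<Rightarrow> real) \<Rightarrow> real" where
  "Cr_norm r f = Max ((\<lambda>k. sup_norm (multi_deriv k f)) ` {k. (\<Sum>i\<in>UNIV. k i) \<le> r})"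

definition test_ball :: "nat \<Rightarrow> (real ^ 'n::finite \<Rightarrow> real) set" where
  "test_ball r = {\<psi> \<in> test_functions_in (cball 0 1). Cr_norm r \<psi> \<le> 1}"

text \<open>\<open>rescale \<phi> x \<epsilon>\<close> is \<open>\<phi>\<^sub>x\<^sup>\<epsilon>\<close>, meant for \<open>\<epsilon> > 0\<close>.\<close>

definition rescale :: "(real ^ 'n::finite \<Rightarrow> real) \<Rightarrow> real ^ 'n \<Rightarrow> real \<Rightarrow> (real ^ 'n \<Rightarrow> real)" where
  "rescale \<phi> x \<epsilon> = (\<lambda>z. inverse (\<epsilon> ^ CARD('n)) * \<phi> (inverse \<epsilon> *\<^sub>R (z - x)))"

definition enlarge :: "(real ^ 'n) set \<Rightarrow> real \<Rightarrow> (real ^ 'n) set" where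
  "enlarge K R = {x + y | x y. x \<in> K \<and> y \<in> cball 0 R}"

section \<open>Distributions and negative Hoelder spaces\<close>

text \<open>
  A distribution is a linear functional on test functions that is continuous in the sense of the
  usual seminorm estimates on each compact set. It is represented by a total function
  whose values outside \<open>test_functions\<close> are irrelevant.
\<close>

definition distributions :: "((real ^ 'n::finite \<Rightarrow> real) \<Rightarrow> real) set" where
  "distributions = {T.
     (\<forall>\<phi>\<in>test_functions. \<forall>\<psi>\<in>test_functions. T (\<lambda>z. \<phi> z + \<psi> z) = T \<phi> + T \<psi>) \<and>
     (\<forall>c. \<forall>\<phi>\<in>test_functions. T (\<lambda>z. c * \<phi> z) = c * T \<phi>) \<and>
     (\<forall>K. compact K \<longrightarrow>
        (\<exists>r C. \<forall>\<phi>\<in>test_functions_in K. \<bar>T \<phi>\<bar> \<le> C * Cr_norm r \<phi>))}"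

definition r_index :: "real \<Rightarrow> nat" where
  "r_index \<alpha> = (LEAST r. 1 \<le> r \<and> real r > - \<alpha>)"

definition negative_Hoelder :: "real \<Rightarrow> ((real ^ 'n::finite \<Rightarrow> real) \<Rightarrow> real) set" where
  "negative_Hoelder \<alpha> = {T \<in> distributions.
     \<forall>K. compact K \<longrightarrow>
       (\<exists>C. \<forall>x\<in>K. \<forall>\<epsilon>\<in>{0<..1}. \<forall>\<psi>\<in>test_ball (r_index \<alpha>).
          \<bar>T (rescale \<psi> x \<epsilon>)\<bar> \<le> C * \<epsilon> powr \<alpha>)}"

text \<open>
  Suprema that may be infinite are taken in \<open>ennreal\<close>; in particular a supremum over
  the empty set is \<open>0\<close>.
\<close>

definition Hoelder_seminorm ::
  "real \<Rightarrow> (real ^ 'n::finite) set \<Rightarrow> ((real ^ 'n \<Rightarrow> real) \<Rightarrow> real) \<Rightarrow> ennreal" where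
  "Hoelder_seminorm \<alpha> K T =
     (SUP x\<in>K. SUP \<epsilon>\<in>{0<..1}. SUP \<psi>\<in>test_ball (r_index \<alpha>).
        ennreal (\<bar>T (rescale \<psi> x \<epsilon>)\<bar> / \<epsilon> powr \<alpha>))"

text \<open>The parameter \<open>R\<close> is the radius of a ball around the origin containing \<open>supp \<phi>\<close>.\<close>

definition frakb :: "(real ^ 'n::finite \<Rightarrow> real) \<Rightarrow> real \<Rightarrow> real \<Rightarrow> nat \<Rightarrow> real" where
  "frakb \<phi> R \<alpha> r =
     (4 powr (real CARD('n) - \<alpha> + 1) * exp 4 * 2 powr (- \<alpha> * (real r + 1)) * (real r)\<^sup>2
        / (1 - 2 powr (- \<alpha> - real r)))
     * ((1 + R) powr (- \<alpha>) * (LINT z|lborel. \<bar>\<phi> z\<bar>) / \<bar>LINT z|lborel. \<phi> z\<bar>\<^sup>2)"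

end

theory Submission
  imports Defs
begin

text \<open>
  The implication from the full bound to the bound for one test function is easy: a multiple of a
  smooth bump lies in the unit ball \<open>test_ball r\<close>. Everything else says that a bound on
  \<open>T (rescale \<phi> y \<epsilon>)\<close> for one \<open>\<phi>\<close> with \<open>\<integral>\<phi> \<noteq> 0\<close>, at dyadic scales only, controls
  \<open>T (rescale \<psi> x \<mu>)\<close> for all \<open>\<psi>\<close> in \<open>test_ball r\<close>, with an explicit constant.

  The idea is to rebuild an arbitrary test function \<open>g\<close> from copies of \<open>\<phi>\<close>. First, \<open>\<phi>\<close> is improved:
  a linear combination \<open>kernel \<epsilon>\<close> of \<open>r\<close> rescaled copies of \<open>\<phi>\<close>, at scales
  \<open>\<epsilon> s / 2\<^sup>i\<close> with \<open>i < r\<close>, has integral one and vanishing moments of the orders \<open>1, \<dots>, r - 1\<close>. This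
  is polynomial extrapolation to \<open>0\<close> at the nodes \<open>s / 2\<^sup>i\<close>, and the weights are at most
  \<open>exp 2 / \<bar>\<integral>\<phi>\<bar>\<close> in absolute value, independently of \<open>r\<close> (\<open>abs_extrapolation_weight_le\<close>). By Taylor's
  formula, convolution with \<open>kernel \<eta>\<close> then changes a smooth function \<open>g\<close> by at most a multiple of
  \<open>\<eta>\<^sup>r\<close> times the size of its derivatives of order \<open>r\<close> (\<open>conv_kernel_approx\<close>).

  Write \<open>k\<^sub>\<eta>\<close> for \<open>kernel \<eta>\<close> and put \<open>G n = k\<^bsub>2\<epsilon>\<^esub> * k\<^sub>\<epsilon> * g\<close> with \<open>\<epsilon> = 2\<^sup>-\<^sup>n\<close>.
  Then \<open>T (G n)\<close> tends to \<open>T g\<close>, and since the factor \<open>k\<^sub>\<epsilon>\<close> is common to both terms,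
  \<open>G (n + 1) - G n = k\<^sub>\<epsilon> * (k\<^bsub>\<epsilon>/2\<^esub> * g - k\<^bsub>2\<epsilon>\<^esub> * g)\<close>. The bracket is a function \<open>u\<close> of size
  \<open>O(\<epsilon>\<^sup>r)\<close>, and \<open>k\<^sub>\<epsilon> * u\<close> is a superposition of translates of \<open>k\<^sub>\<epsilon>\<close>, that is, of translates of \<open>\<phi>\<close> at
  scales comparable to \<open>\<epsilon>\<close>. As \<open>T\<close> may be exchanged with such a superposition
  (\<open>distribution_superposition\<close>), the hypothesis bounds \<open>T (k\<^sub>\<epsilon> * u)\<close> by a multiple of \<open>\<epsilon>\<^sup>\<alpha> \<epsilon>\<^sup>r\<close>.
  These bounds are summable because \<open>\<alpha> + r > 0\<close>. For \<open>g = rescale \<psi> x \<mu>\<close> the telescoping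
  series is started at the first \<open>n\<close> with \<open>2\<^sup>-\<^sup>n \<le> \<mu>\<close>, which gives the power \<open>\<mu>\<^sup>\<alpha>\<close>
  (\<open>smeared_test_function_le\<close>).

  The explicit constant is met as follows. The parameter \<open>s\<close> is chosen such that \<open>kernel \<epsilon>\<close> is
  supported in the ball of radius \<open>\<epsilon> / 8\<close>. All functions that occur then live in a ball of radius
  \<open>5/4 \<mu>\<close>, whose volume is at most \<open>(5/2 \<mu>)\<^sup>d\<close>, while the Taylor remainder carries
  the factor \<open>(d/4)\<^sup>r / r! \<le> exp (d/4) \<le> (8/5)\<^sup>d\<close>. The two combine to at most \<open>4\<^sup>d\<^sup>+\<^sup>1\<close>
  (\<open>dimension_constant_le\<close>). The small nodes cost a factor \<open>8 powr - \<alpha>\<close>, which is exactly what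
  the powers of \<open>2\<close> and \<open>4\<close> in \<open>frakb\<close> leave room for.
\<close>

section \<open>Smooth functions and iterated partial derivatives\<close>

lemma partial_deriv_eqI:
  assumes "(f has_derivative f') (at x)"
  shows "partial_deriv i f x = f' (axis i 1)"
  using frechet_derivative_at[OF assms] by (simp add: partial_deriv_def)

lemma smooth_partial_deriv: "smooth f \<Longrightarrow> smooth (partial_deriv i f)"
  unfolding smooth_def by (metis times_cont_diff.simps(2))

lemma smooth_differentiable: "smooth f \<Longrightarrow> f differentiable (at x)"
  unfolding smooth_def by (metis times_cont_diff.simps(2))

lemma smooth_continuous_on: "smooth f \<Longrightarrow> continuous_on S f"
  unfolding smooth_def by (metis times_cont_diff.simps(1) continuous_on_subset subset_UNIV)

text \<open>
  Smoothness is the largest property of functions that implies differentiability and is inherited by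
  partial derivatives. Closure properties of smooth functions follow by exhibiting such a class.
\<close>

lemma smooth_coinduct:
  assumes "P f"
    and diff: "\<And>f x. P f \<Longrightarrow> f differentiable (at x)"
    and step: "\<And>f i. P f \<Longrightarrow> P (partial_deriv i f)"
  shows "smooth f"
proof -
  have "P f \<Longrightarrow> times_cont_diff m f" for m f
  proof (induction m arbitrary: f)
    case 0
    then show ?case
      using diff by (auto intro!: differentiable_imp_continuous_on simp: differentiable_on_def)
  qed (auto simp: diff step)
  with assms(1) show ?thesis
    by (simp add: smooth_def)
qed

lemma smooth_has_derivative:
  fixes f :: "real ^ 'n \<Rightarrow> real"
  assumes "smooth f"
  shows "(f has_derivative (\<lambda>h. \<Sum>i\<in>UNIV. h $ i * partial_deriv i f x)) (at x)"
proof -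
  obtain f' where f': "(f has_derivative f') (at x)"
    using smooth_differentiable[OF assms] unfolding differentiable_def by blast
  have lin: "linear f'"
    using f' has_derivative_linear by blast
  have "f' h = (\<Sum>i\<in>UNIV. h $ i * partial_deriv i f x)" for h
  proof -
    have "f' h = f' (\<Sum>i\<in>UNIV. (h $ i) *\<^sub>R axis i 1)"
      using basis_expansion[of h] by (simp add: scalar_mult_eq_scaleR)
    also have "\<dots> = (\<Sum>i\<in>UNIV. h $ i * f' (axis i 1))"
      by (simp add: linear_sum[OF lin] linear_scale[OF lin])
    finally show ?thesis
      by (simp add: partial_deriv_eqI[OF f'])
  qed
  with f' show ?thesis
    by (metis (no_types, lifting) ext)
qed

lemma partial_deriv_lincomb:
  assumes "f differentiable (at x)" "g differentiable (at x)"
  shows "partial_deriv i (\<lambda>x. a * f x + b * g x) x = a * partial_deriv i f x + b * partial_deriv i g x"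
proof -
  obtain f' g' where f': "(f has_derivative f') (at x)" and g': "(g has_derivative g') (at x)"
    using assms unfolding differentiable_def by blast
  have "((\<lambda>x. a * f x + b * g x) has_derivative (\<lambda>h. a * f' h + b * g' h)) (at x)"
    by (intro derivative_intros f' g')
  from partial_deriv_eqI[OF this] show ?thesis
    by (simp add: partial_deriv_eqI[OF f'] partial_deriv_eqI[OF g'])
qed

lemma smooth_lincomb:
  assumes "smooth f" "smooth g"
  shows "smooth (\<lambda>x. a * f x + b * g x)"
proof (rule smooth_coinduct[where P="\<lambda>u. \<exists>f g. smooth f \<and> smooth g \<and> u = (\<lambda>x. a * f x + b * g x)"])
  show "\<exists>f' g'. smooth f' \<and> smooth g' \<and> (\<lambda>x. a * f x + b * g x) = (\<lambda>x. a * f' x + b * g' x)"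
    using assms by blast
next
  fix u :: "real ^ 'a \<Rightarrow> real" and x
  assume "\<exists>f g. smooth f \<and> smooth g \<and> u = (\<lambda>x. a * f x + b * g x)"
  then obtain f g where fg: "smooth f" "smooth g" and u: "u = (\<lambda>x. a * f x + b * g x)"
    by blast
  show "u differentiable at x"
    unfolding u using fg[THEN smooth_differentiable]
    by (intro differentiable_add differentiable_mult differentiable_const)
next
  fix u :: "real ^ 'a \<Rightarrow> real" and i
  assume "\<exists>f g. smooth f \<and> smooth g \<and> u = (\<lambda>x. a * f x + b * g x)"
  then obtain f g where fg: "smooth f" "smooth g" and u: "u = (\<lambda>x. a * f x + b * g x)"
    by blast
  have "partial_deriv i u = (\<lambda>x. a * partial_deriv i f x + b * partial_deriv i g x)"
    unfolding u by (rule ext) (intro partial_deriv_lincomb smooth_differentiable fg)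
  then show "\<exists>f g. smooth f \<and> smooth g \<and> partial_deriv i u = (\<lambda>x. a * f x + b * g x)"
    using fg smooth_partial_deriv by blast
qed

lemma smooth_const: "smooth (\<lambda>x. k)"
proof (rule smooth_coinduct[where P="\<lambda>u. \<exists>k. u = (\<lambda>x. k)"])
  fix u :: "real ^ 'n \<Rightarrow> real" and i
  assume "\<exists>k. u = (\<lambda>x. k)"
  then obtain k where u: "u = (\<lambda>x. k)" by blast
  have "(u has_derivative (\<lambda>h. 0)) (at x)" for x
    unfolding u by simp
  from partial_deriv_eqI[OF this] show "\<exists>k. partial_deriv i u = (\<lambda>x. k)"
    by auto
qed auto

lemma smooth_affine:
  assumes "smooth f"
  shows "smooth (\<lambda>x. k * f (c *\<^sub>R (x - a)))"
    and partial_deriv_affine: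
      "partial_deriv i (\<lambda>x. k * f (c *\<^sub>R (x - a))) = (\<lambda>x. k * c * partial_deriv i f (c *\<^sub>R (x - a)))"
proof -
  have *: "((\<lambda>x. k * f (c *\<^sub>R (x - a))) has_derivative
      (\<lambda>h. k * (\<Sum>i\<in>UNIV. (c *\<^sub>R h) $ i * partial_deriv i f (c *\<^sub>R (x - a))))) (at x)"
    if "smooth f" for f x k
  proof -
    have "((\<lambda>x. c *\<^sub>R (x - a)) has_derivative (\<lambda>h. c *\<^sub>R h)) (at x)"
      by (auto intro!: derivative_eq_intros)
    from has_derivative_compose[OF this smooth_has_derivative[OF that]]
    show ?thesis
      by (auto intro!: derivative_intros)
  qed
  have pd: "partial_deriv i (\<lambda>x. k * f (c *\<^sub>R (x - a))) = (\<lambda>x. k * c * partial_deriv i f (c *\<^sub>R (x - a)))"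
    if "smooth f" for f i k
    by (rule ext, subst partial_deriv_eqI[OF *[OF that]])
      (simp add: axis_def if_distrib if_distribR cong: if_cong)
  show "partial_deriv i (\<lambda>x. k * f (c *\<^sub>R (x - a))) = (\<lambda>x. k * c * partial_deriv i f (c *\<^sub>R (x - a)))"
    by (rule pd[OF assms])
  show "smooth (\<lambda>x. k * f (c *\<^sub>R (x - a)))"
  proof (rule smooth_coinduct[where P="\<lambda>u. \<exists>f k. smooth f \<and> u = (\<lambda>x. k * f (c *\<^sub>R (x - a)))"])
    show "\<exists>f' k'. smooth f' \<and> (\<lambda>x. k * f (c *\<^sub>R (x - a))) = (\<lambda>x. k' * f' (c *\<^sub>R (x - a)))"
      using assms by blast
  next
    fix u :: "real ^ 'a \<Rightarrow> real" and x
    assume "\<exists>f k. smooth f \<and> u = (\<lambda>x. k * f (c *\<^sub>R (x - a)))"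
    then show "u differentiable at x"
      using * unfolding differentiable_def by blast
  next
    fix u :: "real ^ 'a \<Rightarrow> real" and i
    assume "\<exists>f k. smooth f \<and> u = (\<lambda>x. k * f (c *\<^sub>R (x - a)))"
    then show "\<exists>f k. smooth f \<and> partial_deriv i u = (\<lambda>x. k * f (c *\<^sub>R (x - a)))"
      using pd smooth_partial_deriv by blast
  qed
qed

definition pders :: "'n list \<Rightarrow> (real ^ 'n \<Rightarrow> real) \<Rightarrow> (real ^ 'n \<Rightarrow> real)" where
  "pders js f = foldr partial_deriv js f"

lemma pders_Nil [simp]: "pders [] f = f"
  and pders_Cons [simp]: "pders (j # js) f = partial_deriv j (pders js f)"
  and pders_append: "pders (js @ ks) f = pders js (pders ks f)"
  by (simp_all add: pders_def)

lemma smooth_pders: "smooth f \<Longrightarrow> smooth (pders js f)"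
  by (induction js) (auto intro: smooth_partial_deriv)

lemma pders_lincomb:
  assumes "smooth f" "smooth g"
  shows "pders js (\<lambda>x. a * f x + b * g x) = (\<lambda>x. a * pders js f x + b * pders js g x)"
proof (induction js)
  case (Cons j js)
  show ?case
    unfolding pders_Cons Cons.IH
    by (rule ext) (intro partial_deriv_lincomb smooth_differentiable smooth_pders assms)
qed simp

lemma pders_affine:
  assumes "smooth f"
  shows "pders js (\<lambda>x. k * f (c *\<^sub>R (x - a))) = (\<lambda>x. k * c ^ length js * pders js f (c *\<^sub>R (x - a)))"
proof (induction js)
  case (Cons j js)
  show ?case
    unfolding pders_Cons Cons.IH
    by (subst partial_deriv_affine[OF smooth_pders[OF assms]]) (simp add: mult_ac)
qed simp

lemma smooth_sum:
  assumes "finite F" "\<And>q. q \<in> F \<Longrightarrow> smooth (f q)"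
  shows "smooth (\<lambda>x. \<Sum>q\<in>F. w q * f q x)"
    and pders_sum: "pders js (\<lambda>x. \<Sum>q\<in>F. w q * f q x) = (\<lambda>x. \<Sum>q\<in>F. w q * pders js (f q) x)"
proof -
  have zero: "pders js (\<lambda>x. 0) = (\<lambda>x. 0)" for js :: "'b list"
    using pders_lincomb[OF smooth_const[of 0] smooth_const[of 0], of js 0 0] by simp
  have "smooth (\<lambda>x. \<Sum>q\<in>F. w q * f q x) \<and>
      pders js (\<lambda>x. \<Sum>q\<in>F. w q * f q x) = (\<lambda>x. \<Sum>q\<in>F. w q * pders js (f q) x)"
    using assms
  proof (induction F rule: finite_induct)
    case empty
    then show ?case by (simp add: smooth_const zero)
  next
    case (insert q F)
    then have 1: "smooth (f q)" "smooth (\<lambda>x. \<Sum>q\<in>F. w q * f q x)"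
      by auto
    show ?case
      using smooth_lincomb[OF 1, of "w q" 1] pders_lincomb[OF 1, of js "w q" 1] insert
      by simp
  qed
  then show "smooth (\<lambda>x. \<Sum>q\<in>F. w q * f q x)"
    and "pders js (\<lambda>x. \<Sum>q\<in>F. w q * f q x) = (\<lambda>x. \<Sum>q\<in>F. w q * pders js (f q) x)"
    by auto
qed

definition dir_deriv :: "real ^ 'n \<Rightarrow> (real ^ 'n \<Rightarrow> real) \<Rightarrow> (real ^ 'n \<Rightarrow> real)" where
  "dir_deriv h f = (\<lambda>x. \<Sum>i\<in>UNIV. h $ i * partial_deriv i f x)"

lemma smooth_dir_deriv: "smooth f \<Longrightarrow> smooth (dir_deriv h f)"
  unfolding dir_deriv_def by (intro smooth_sum) (auto intro: smooth_partial_deriv)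

lemma dir_deriv_axis: "dir_deriv (axis i 1) f = partial_deriv i f"
  by (rule ext) (simp add: dir_deriv_def axis_def if_distrib if_distribR cong: if_cong)

lemma DERIV_along_line:
  assumes "smooth f"
  shows "((\<lambda>t. f (x + t *\<^sub>R h)) has_real_derivative dir_deriv h f (x + t *\<^sub>R h)) (at t)"
proof -
  have "((\<lambda>t. x + t *\<^sub>R h) has_derivative (\<lambda>s. s *\<^sub>R h)) (at t)"
    by (auto intro!: derivative_eq_intros)
  from has_derivative_compose[OF this smooth_has_derivative[OF assms]]
  show ?thesis
    unfolding has_field_derivative_def
    by (rule has_derivative_eq_rhs) (auto simp: dir_deriv_def sum_distrib_left mult_ac)
qed

text \<open>
  Applying the mean value theorem first in direction \<open>i\<close> and then in direction \<open>j\<close> gives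
  \<open>\<partial>\<^sub>j \<partial>\<^sub>i f\<close>. The left-hand side is symmetric in \<open>i\<close> and \<open>j\<close>, and this symmetry is the reason why
  partial derivatives commute.
\<close>

lemma second_difference:
  assumes "smooth f" "s > 0"
  shows "\<exists>p. dist p x \<le> 2 * s \<and>
    f (x + s *\<^sub>R axis i 1 + s *\<^sub>R axis j 1) - f (x + s *\<^sub>R axis i 1) - f (x + s *\<^sub>R axis j 1) + f x
      = s * s * partial_deriv j (partial_deriv i f) p"
proof -
  let ?i = "axis i 1 :: real ^ 'a" and ?j = "axis j 1 :: real ^ 'a"
  define u where "u t = f ((x + s *\<^sub>R ?j) + t *\<^sub>R ?i) - f (x + t *\<^sub>R ?i)" for t
  have "\<exists>z. 0 < z \<and> z < s \<and> u s - u 0 = (s - 0) *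
     (partial_deriv i f ((x + s *\<^sub>R ?j) + z *\<^sub>R ?i) - partial_deriv i f (x + z *\<^sub>R ?i))"
    unfolding u_def dir_deriv_axis[symmetric]
    by (rule MVT2[OF \<open>s > 0\<close>]) (intro DERIV_diff DERIV_along_line assms)
  then obtain z where z: "0 < z" "z < s" and 1: "u s - u 0 = (s - 0) *
     (partial_deriv i f ((x + s *\<^sub>R ?j) + z *\<^sub>R ?i) - partial_deriv i f (x + z *\<^sub>R ?i))"
    by blast
  have "\<exists>z'. 0 < z' \<and> z' < s \<and> partial_deriv i f (x + z *\<^sub>R ?i + s *\<^sub>R ?j) -
      partial_deriv i f (x + z *\<^sub>R ?i + 0 *\<^sub>R ?j)
      = (s - 0) * partial_deriv j (partial_deriv i f) (x + z *\<^sub>R ?i + z' *\<^sub>R ?j)"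
    unfolding dir_deriv_axis[symmetric, of j]
    by (rule MVT2[OF \<open>s > 0\<close>]) (intro DERIV_along_line smooth_partial_deriv assms)
  then obtain z' where z': "0 < z'" "z' < s" and 2: "partial_deriv i f (x + z *\<^sub>R ?i + s *\<^sub>R ?j) -
      partial_deriv i f (x + z *\<^sub>R ?i + 0 *\<^sub>R ?j)
      = (s - 0) * partial_deriv j (partial_deriv i f) (x + z *\<^sub>R ?i + z' *\<^sub>R ?j)"
    by blast
  let ?p = "x + z *\<^sub>R ?i + z' *\<^sub>R ?j"
  have "dist ?p x = norm (z *\<^sub>R ?i + z' *\<^sub>R ?j)"
    by (simp add: dist_norm add.assoc)
  also have "\<dots> \<le> norm (z *\<^sub>R ?i) + norm (z' *\<^sub>R ?j)"
    by (rule norm_triangle_ineq)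
  also have "\<dots> \<le> 2 * s"
    using z z' by simp
  finally have "dist ?p x \<le> 2 * s" .
  moreover have "u s - u 0 = s * s * partial_deriv j (partial_deriv i f) ?p"
    using 1 2 by (simp add: add_ac)
  ultimately show ?thesis
    by (intro exI[of _ ?p]) (simp add: u_def add_ac)
qed

lemma partial_deriv_commute:
  assumes "smooth f"
  shows "partial_deriv i (partial_deriv j f) = partial_deriv j (partial_deriv i f)"
proof
  fix x
  define s where "s n = 1 / (2 * real (Suc n))" for n
  have s: "s n > 0" for n
    by (simp add: s_def)
  have "\<exists>p q. dist p x \<le> 2 * s n \<and> dist q x \<le> 2 * s n \<and>
      partial_deriv j (partial_deriv i f) p = partial_deriv i (partial_deriv j f) q" for n
  proof -
    obtain p where p: "dist p x \<le> 2 * s n" 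
      "f (x + s n *\<^sub>R axis i 1 + s n *\<^sub>R axis j 1) - f (x + s n *\<^sub>R axis i 1) - f (x + s n *\<^sub>R axis j 1) + f x
      = s n * s n * partial_deriv j (partial_deriv i f) p"
      using second_difference[OF assms s[of n], of x i j] by blast
    obtain q where q: "dist q x \<le> 2 * s n" 
      "f (x + s n *\<^sub>R axis j 1 + s n *\<^sub>R axis i 1) - f (x + s n *\<^sub>R axis j 1) - f (x + s n *\<^sub>R axis i 1) + f x
      = s n * s n * partial_deriv i (partial_deriv j f) q"
      using second_difference[OF assms s[of n], of x j i] by blast
    have comm: "x + s n *\<^sub>R axis j 1 + s n *\<^sub>R axis i 1 = x + s n *\<^sub>R axis i 1 + s n *\<^sub>R axis j 1"
      by (simp add: add_ac)
    have "s n * s n * partial_deriv j (partial_deriv i f) p = s n * s n * partial_deriv i (partial_deriv j f) q"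
      using p(2) q(2)[unfolded comm] by linarith
    then show ?thesis
      using p(1) q(1) s[of n] by auto
  qed
  then obtain p q where p: "\<And>n. dist (p n) x \<le> 2 * s n" and q: "\<And>n. dist (q n) x \<le> 2 * s n"
    and pq: "\<And>n. partial_deriv j (partial_deriv i f) (p n) = partial_deriv i (partial_deriv j f) (q n)"
    by metis
  have s0: "(\<lambda>n. 2 * s n) \<longlonglongrightarrow> 0"
    unfolding s_def by (rule LIMSEQ_Suc[of "\<lambda>n. 2 * (1 / (2 * real n))"]) (simp add: lim_inverse_n')
  have plim: "p \<longlonglongrightarrow> x"
    by (rule metric_tendsto_imp_tendsto[OF s0]) (use p s in \<open>auto simp: dist_real_def abs_of_pos\<close>)
  have qlim: "q \<longlonglongrightarrow> x"
    by (rule metric_tendsto_imp_tendsto[OF s0]) (use q s in \<open>auto simp: dist_real_def abs_of_pos\<close>)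
  have cont: "isCont (partial_deriv a (partial_deriv b f)) x" for a b
    using smooth_continuous_on[OF smooth_partial_deriv[OF smooth_partial_deriv[OF assms]], of UNIV]
    by (simp add: continuous_on_eq_continuous_at)
  have "(\<lambda>n. partial_deriv j (partial_deriv i f) (p n)) \<longlonglongrightarrow> partial_deriv j (partial_deriv i f) x"
    by (rule isCont_tendsto_compose[OF cont plim])
  moreover have "(\<lambda>n. partial_deriv i (partial_deriv j f) (q n)) \<longlonglongrightarrow> partial_deriv i (partial_deriv j f) x"
    by (rule isCont_tendsto_compose[OF cont qlim])
  ultimately show "partial_deriv i (partial_deriv j f) x = partial_deriv j (partial_deriv i f) x"
    unfolding pq by (rule LIMSEQ_unique[symmetric])
qed

text \<open>
  The derivatives in \<^const>\<open>multi_deriv\<close> are taken in one fixed order. Commutation reduces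
  all other orders, which appear in Taylor's formula, to this one.
\<close>

lemma pders_move:
  assumes "smooth f"
  shows "pders (i # js @ ks) f = pders (js @ i # ks) f"
proof (induction js)
  case (Cons j js)
  then show ?case
    using partial_deriv_commute[OF smooth_pders[OF assms], of i j "js @ ks"] by simp
qed simp

definition multi_list :: "'n list \<Rightarrow> ('n \<Rightarrow> nat) \<Rightarrow> 'n list" where
  "multi_list js k = concat (map (\<lambda>j. replicate (k j) j) js)"

lemma coord_list: "distinct (coord_list :: 'n::finite list)" "set (coord_list :: 'n::finite list) = UNIV"
proof -
  have "\<exists>js :: 'n list. distinct js \<and> set js = UNIV"
    using finite_distinct_list[of "UNIV :: 'n set"] by auto
  from someI_ex[OF this]
  show "distinct (coord_list :: 'n::finite list)" "set (coord_list :: 'n::finite list) = UNIV"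
    by (auto simp: coord_list_def)
qed

lemma multi_deriv_eq_pders: "multi_deriv k f = pders (multi_list coord_list k) f"
proof -
  have rep: "pders (replicate m i) f = (partial_deriv i ^^ m) f" for m i and f :: "real ^ 'a \<Rightarrow> real"
    by (induction m) auto
  have "foldr (\<lambda>i. partial_deriv i ^^ k i) js f = pders (multi_list js k) f" for js
    by (induction js) (auto simp: multi_list_def pders_append rep)
  then show ?thesis
    by (simp add: multi_deriv_def)
qed

lemma pders_eq_multi_deriv:
  fixes js :: "'n::finite list"
  assumes "smooth f"
  shows "pders js f = multi_deriv (count_list js) f"
proof (induction js)
  case Nil
  have "multi_list js (\<lambda>_. 0) = []" for js :: "'n list"
    by (simp add: multi_list_def)
  moreover have "count_list ([]::'n list) = (\<lambda>_. 0)"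
    by auto
  ultimately show ?case by (simp add: multi_deriv_eq_pders)
next
  case (Cons j js)
  have "j \<in> set coord_list"
    by (simp add: coord_list)
  then obtain as bs where ab: "coord_list = as @ j # bs"
    using split_list by metis
  then have nj: "j \<notin> set as" "j \<notin> set bs"
    using coord_list(1)[where 'n='n] unfolding ab by auto
  let ?k = "count_list js" and ?k' = "count_list (j # js)"
  \<comment> \<open>Only the block of \<open>j\<close> grows, by one entry, which \<open>pders_move\<close> brings to the front.\<close>
  have as: "multi_list as ?k' = multi_list as ?k" and bs: "multi_list bs ?k' = multi_list bs ?k"
    using nj unfolding multi_list_def by (auto intro!: arg_cong[where f=concat] map_cong)
  have "multi_list coord_list ?k = multi_list as ?k @ (replicate (?k j) j @ multi_list bs ?k)"
    unfolding ab by (simp add: multi_list_def)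
  moreover have "multi_list coord_list ?k' = multi_list as ?k @ j # (replicate (?k j) j @ multi_list bs ?k)"
    unfolding ab using as bs by (simp add: multi_list_def)
  ultimately show ?case
    using Cons.IH pders_move[OF assms] by (simp add: multi_deriv_eq_pders del: count_list.simps)
qed

lemma sum_count_list_UNIV: "(\<Sum>i\<in>UNIV. count_list js i) = length (js :: 'n::finite list)"
  by (rule sum_count_set) auto

lemma length_multi_list: "length (multi_list coord_list k) = (\<Sum>i\<in>UNIV. k (i :: 'n::finite))"
proof -
  have "length (multi_list js k) = sum_list (map k js)" for js
    by (induction js) (auto simp: multi_list_def)
  then show ?thesis
    using coord_list[where 'n='n] by (simp add: sum_list_distinct_conv_sum_set)
qed


section \<open>Test functions\<close>

lemma supp_subset_iff: "closed K \<Longrightarrow> supp f \<subseteq> K \<longleftrightarrow> (\<forall>z. f z \<noteq> 0 \<longrightarrow> z \<in> K)"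
  unfolding supp_def using closure_minimal[of "{x. f x \<noteq> 0}" K] closure_subset[of "{x. f x \<noteq> 0}"] by auto

lemma supp_memI: "f z \<noteq> 0 \<Longrightarrow> z \<in> supp f"
  unfolding supp_def using closure_subset[of "{x. f x \<noteq> 0}"] by auto

lemma test_functionsI:
  assumes "smooth f" "\<And>z. f z \<noteq> 0 \<Longrightarrow> norm z \<le> R"
  shows "f \<in> test_functions"
proof -
  have "supp f \<subseteq> cball 0 R"
    using assms(2) by (subst supp_subset_iff) auto
  moreover have "closed (supp f)"
    by (simp add: supp_def)
  ultimately have "compact (supp f)"
    using compact_cball compact_eq_bounded_closed bounded_subset by blast
  with assms(1) show ?thesis
    by (simp add: test_functions_def)
qed

lemma test_functions_bounded_support:
  assumes "f \<in> test_functions"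
  obtains R where "\<And>z. f z \<noteq> 0 \<Longrightarrow> norm z \<le> R"
proof -
  have "bounded (supp f)"
    using assms compact_imp_bounded by (auto simp: test_functions_def)
  then obtain R where "\<forall>z\<in>supp f. norm z \<le> R"
    unfolding bounded_iff by blast
  then show ?thesis
    using that[of R] supp_memI[of f] by blast
qed

lemma test_functions_smooth: "f \<in> test_functions \<Longrightarrow> smooth f"
  by (simp add: test_functions_def)

lemma test_functions_continuous: "f \<in> test_functions \<Longrightarrow> continuous_on S f"
  by (simp add: smooth_continuous_on test_functions_smooth)

lemma test_functions_inI:
  assumes "f \<in> test_functions" "closed K" "\<And>z. f z \<noteq> 0 \<Longrightarrow> z \<in> K"
  shows "f \<in> test_functions_in K"
  using assms by (simp add: test_functions_in_def supp_subset_iff)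

lemma partial_deriv_eq_0:
  assumes "closed K" "\<And>z. f z \<noteq> 0 \<Longrightarrow> z \<in> K" "partial_deriv i f z \<noteq> 0"
  shows "z \<in> K"
proof (rule ccontr)
  assume z: "z \<notin> K"
  have "((\<lambda>z. 0::real) has_derivative (\<lambda>h. 0)) (at z)"
    by simp
  then have "(f has_derivative (\<lambda>h. 0)) (at z)"
    by (rule has_derivative_transform_within_open[of _ _ _ _ "-K"]) (use assms z in auto)
  from partial_deriv_eqI[OF this] assms(3) show False
    by simp
qed

lemma pders_support:
  assumes "closed K" "\<And>z. f z \<noteq> 0 \<Longrightarrow> z \<in> K"
  shows "pders js f z \<noteq> 0 \<Longrightarrow> z \<in> K"
proof (induction js arbitrary: z)
  case (Cons j js)
  then show ?case
    using partial_deriv_eq_0[OF assms(1)] by (metis pders_Cons)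
qed (simp add: assms)

lemma test_functions_pders:
  assumes "f \<in> test_functions"
  shows "pders js f \<in> test_functions"
proof -
  obtain R where "\<And>z. f z \<noteq> 0 \<Longrightarrow> norm z \<le> R"
    using test_functions_bounded_support[OF assms] by blast
  then have "pders js f z \<noteq> 0 \<Longrightarrow> norm z \<le> R" for z
    using pders_support[of "cball 0 R" f] by auto
  with smooth_pders[OF test_functions_smooth[OF assms]] show ?thesis
    by (rule test_functionsI)
qed

lemma test_functions_partial_deriv: "f \<in> test_functions \<Longrightarrow> partial_deriv i f \<in> test_functions"
  using test_functions_pders[of f "[i]"] by simp

lemma test_functions_bounded:
  assumes "f \<in> test_functions"
  obtains M where "M \<ge> 0" "\<And>z. \<bar>f z\<bar> \<le> M"
proof -
  have "compact (supp f)"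
    using assms by (simp add: test_functions_def)
  then have "compact (f ` supp f)"
    by (intro compact_continuous_image test_functions_continuous assms)
  from compact_imp_bounded[OF this] obtain M where M: "\<forall>y\<in>f ` supp f. norm y \<le> M"
    unfolding bounded_iff by blast
  have "\<bar>f z\<bar> \<le> max M 0" for z
  proof (cases "f z = 0")
    case False
    then have "f z \<in> f ` supp f"
      by (intro imageI supp_memI)
    with M have "norm (f z) \<le> M"
      by blast
    then show ?thesis
      by simp
  qed simp
  then show ?thesis
    using that[of "max M 0"] by auto
qed

lemma test_functions_lincomb:
  assumes "f \<in> test_functions" "g \<in> test_functions"
  shows "(\<lambda>z. a * f z + b * g z) \<in> test_functions"
proof -
  obtain R where R: "\<And>z. f z \<noteq> 0 \<Longrightarrow> norm z \<le> R"
    using test_functions_bounded_support[OF assms(1)] by blast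
  obtain S where S: "\<And>z. g z \<noteq> 0 \<Longrightarrow> norm z \<le> S"
    using test_functions_bounded_support[OF assms(2)] by blast
  have "norm z \<le> max R S" if "a * f z + b * g z \<noteq> 0" for z
    using R[of z] S[of z] that by (cases "f z = 0") auto
  with smooth_lincomb[OF assms[THEN test_functions_smooth]] show ?thesis
    by (rule test_functionsI)
qed

lemma test_functions_zero: "(\<lambda>z. 0) \<in> test_functions"
  by (rule test_functionsI[of _ 0]) (auto simp: smooth_const)

lemma test_functions_diff:
  assumes "f \<in> test_functions" "g \<in> test_functions"
  shows "(\<lambda>z. f z - g z) \<in> test_functions"
  using test_functions_lincomb[OF assms, of 1 "-1"] by simp

lemma test_functions_sum:
  assumes "finite F" "\<And>q. q \<in> F \<Longrightarrow> f q \<in> test_functions"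
  shows "(\<lambda>z. \<Sum>q\<in>F. w q * f q z) \<in> test_functions"
  using assms
proof (induction F rule: finite_induct)
  case (insert q F)
  then show ?case
    using test_functions_lincomb[of "f q" "\<lambda>z. \<Sum>q\<in>F. w q * f q z" "w q" 1] by simp
qed (simp add: test_functions_zero)

lemma test_functions_affine:
  assumes "f \<in> test_functions" "c \<noteq> 0"
  shows "(\<lambda>z. k * f (c *\<^sub>R (z - a))) \<in> test_functions"
proof -
  obtain R where R: "\<And>z. f z \<noteq> 0 \<Longrightarrow> norm z \<le> R"
    using test_functions_bounded_support[OF assms(1)] by blast
  show ?thesis
  proof (rule test_functionsI)
    show "smooth (\<lambda>z. k * f (c *\<^sub>R (z - a)))"
      by (intro smooth_affine test_functions_smooth assms)
    fix z assume "k * f (c *\<^sub>R (z - a)) \<noteq> 0"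
    then have "\<bar>c\<bar> * norm (z - a) \<le> R"
      using R[of "c *\<^sub>R (z - a)"] by auto
    then have "norm (z - a) \<le> R / \<bar>c\<bar>"
      using assms(2) by (simp add: field_simps)
    then show "norm z \<le> R / \<bar>c\<bar> + norm a"
      using norm_triangle_sub[of z a] by linarith
  qed
qed

lemma test_functions_rescale:
  "f \<in> test_functions \<Longrightarrow> \<epsilon> \<noteq> 0 \<Longrightarrow> rescale f x \<epsilon> \<in> test_functions"
  unfolding rescale_def by (intro test_functions_affine) auto

lemma test_functions_translate:
  "f \<in> test_functions \<Longrightarrow> (\<lambda>z. f (z - y)) \<in> test_functions"
  using test_functions_affine[of f 1 1 y] by simp

lemma pders_translate:
  "smooth f \<Longrightarrow> pders js (\<lambda>z. f (z - y)) = (\<lambda>z. pders js f (z - y))"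
  using pders_affine[of f js 1 1 y] by simp

section \<open>Taylor's formula along a line\<close>

definition l1_norm :: "real ^ 'n \<Rightarrow> real" where
  "l1_norm h = (\<Sum>i\<in>UNIV. \<bar>h $ i\<bar>)"

lemma l1_norm_nonneg [simp]: "l1_norm h \<ge> 0"
  by (simp add: l1_norm_def sum_nonneg)

lemma l1_norm_le: "l1_norm (h :: real ^ 'n) \<le> real CARD('n) * norm h"
  unfolding l1_norm_def
  using sum_bounded_above[of UNIV "\<lambda>i. \<bar>h $ i\<bar>" "norm h"] component_le_norm_cart[of h] by simp

text \<open>
  The \<open>m\<close>-fold derivative in direction \<open>h\<close> is a sum over all sequences \<open>i\<^sub>1, \<dots>, i\<^sub>m\<close> of
  \<open>h\<^bsub>i\<^sub>1\<^esub> \<cdots> h\<^bsub>i\<^sub>m\<^esub>\<close> times a partial derivative of order \<open>m\<close>, and the sum of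
  the absolute values of these coefficients is the \<open>m\<close>-th power of the \<open>l\<^sup>1\<close> norm.
\<close>

lemma abs_dir_deriv_pow_le:
  assumes "smooth f" "\<And>js x. length js = m \<Longrightarrow> \<bar>pders js f x\<bar> \<le> M"
  shows "\<bar>(dir_deriv h ^^ m) f x\<bar> \<le> l1_norm h ^ m * M"
  using assms
proof (induction m arbitrary: f M)
  case (Suc m)
  have "\<bar>pders js (dir_deriv h f) x\<bar> \<le> l1_norm h * M" if "length js = m" for js x
  proof -
    have "pders js (dir_deriv h f) x = (\<Sum>i\<in>UNIV. h $ i * pders js (partial_deriv i f) x)"
      unfolding dir_deriv_def
      by (subst pders_sum) (auto intro: smooth_partial_deriv Suc.prems)
    also have "\<bar>\<dots>\<bar> \<le> (\<Sum>i\<in>UNIV. \<bar>h $ i\<bar> * M)"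
    proof (rule order_trans[OF sum_abs], rule sum_mono)
      fix i
      have "\<bar>pders (js @ [i]) f x\<bar> \<le> M"
        using that by (intro Suc.prems) simp
      then show "\<bar>h $ i * pders js (partial_deriv i f) x\<bar> \<le> \<bar>h $ i\<bar> * M"
        by (simp add: pders_append abs_mult mult_left_mono)
    qed
    finally show ?thesis
      by (simp add: l1_norm_def sum_distrib_right)
  qed
  from Suc.IH[OF smooth_dir_deriv[OF Suc.prems(1)] this]
  show ?case
    by (simp add: funpow_swap1 mult_ac)
next
  case 0
  then show ?case
    using 0(2)[of "[]"] by simp
qed

lemma Taylor_along_line:
  assumes f: "smooth f" and M: "\<And>js x. length js = r \<Longrightarrow> \<bar>pders js f x\<bar> \<le> M"
  shows "\<bar>f (z + t *\<^sub>R h) - (\<Sum>m<r. (dir_deriv h ^^ m) f z / fact m * t ^ m)\<bar>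
    \<le> M * (l1_norm h * \<bar>t\<bar>) ^ r / fact r"
proof -
  let ?D = "\<lambda>m t. (dir_deriv h ^^ m) f (z + t *\<^sub>R h)"
  have sm: "smooth ((dir_deriv h ^^ m) f)" for m
    by (induction m) (auto intro: f smooth_dir_deriv)
  have "\<forall>m t. (?D m has_real_derivative ?D (Suc m) t) (at t)"
    using DERIV_along_line[OF sm] by simp
  from Maclaurin_all_le[of ?D, OF refl this, of t r]
  obtain u where "f (z + t *\<^sub>R h) = (\<Sum>m<r. ?D m 0 / fact m * t ^ m) + ?D r u / fact r * t ^ r"
    by auto
  then have "\<bar>f (z + t *\<^sub>R h) - (\<Sum>m<r. (dir_deriv h ^^ m) f z / fact m * t ^ m)\<bar>
    = \<bar>?D r u\<bar> * \<bar>t\<bar> ^ r / fact r"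
    by (simp add: abs_mult power_abs)
  also have "\<dots> \<le> (l1_norm h ^ r * M) * \<bar>t\<bar> ^ r / fact r"
    by (intro divide_right_mono mult_right_mono abs_dir_deriv_pow_le f M) auto
  finally show ?thesis
    by (simp add: power_mult_distrib mult_ac)
qed

lemma test_functions_pders_bounded:
  fixes f :: "real ^ 'n::finite \<Rightarrow> real"
  assumes "f \<in> test_functions"
  obtains M where "M \<ge> 0" "\<And>js x. length js = r \<Longrightarrow> \<bar>pders js f x\<bar> \<le> M"
proof -
  have "\<exists>M\<ge>0. \<forall>x. \<bar>pders js f x\<bar> \<le> M" for js
    by (rule test_functions_bounded[OF test_functions_pders[OF assms, of js]]) blast
  then obtain M where M: "\<And>js. M js \<ge> 0" "\<And>js x. \<bar>pders js f x\<bar> \<le> M js"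
    by metis
  have fin: "finite {js :: 'n list. length js = r}"
    using finite_lists_length_eq[of "UNIV :: 'n set" r] by simp
  have "\<bar>pders js f x\<bar> \<le> (\<Sum>js | length js = r. M js)" if "length js = r" for js x
    using order_trans[OF M(2) member_le_sum[of js "{js. length js = r}" M]] that M(1) fin by auto
  then show ?thesis
    by (intro that[of "\<Sum>js | length js = r. M js"]) (auto intro: sum_nonneg M(1))
qed

lemma test_functions_Lipschitz:
  assumes "f \<in> test_functions"
  obtains L where "L \<ge> 0" "\<And>x y. \<bar>f x - f y\<bar> \<le> L * norm (x - y)"
proof -
  obtain M where M: "M \<ge> 0" "\<And>js x. length js = 1 \<Longrightarrow> \<bar>pders js f x\<bar> \<le> M"
    using test_functions_pders_bounded[OF assms, of 1] by blast
  have "\<bar>f x - f y\<bar> \<le> M * real CARD('a) * norm (x - y)" for x y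
  proof -
    have "\<bar>f x - f y\<bar> \<le> M * l1_norm (x - y)"
      using Taylor_along_line[OF test_functions_smooth[OF assms] M(2), where r=1 and z=y and t=1 and h="x - y"] by simp
    also have "\<dots> \<le> M * (real CARD('a) * norm (x - y))"
      by (intro mult_left_mono l1_norm_le M)
    finally show ?thesis by (simp add: mult_ac)
  qed
  with M(1) show ?thesis
    by (intro that[of "M * real CARD('a)"]) auto
qed

text \<open>
  The estimate is uniform in the base point, which allows differentiation under
  the integral sign in convolutions.
\<close>

lemma test_functions_second_order:
  assumes "f \<in> test_functions"
  obtains L where "L \<ge> 0" "\<And>z h. \<bar>f (z + h) - f z - dir_deriv h f z\<bar> \<le> L * norm h ^ 2"
proof -
  obtain M where M: "M \<ge> 0" "\<And>js x. length js = 2 \<Longrightarrow> \<bar>pders js f x\<bar> \<le> M"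
    using test_functions_pders_bounded[OF assms, of 2] by blast
  have "\<bar>f (z + h) - f z - dir_deriv h f z\<bar> \<le> M * real CARD('a) ^ 2 * norm h ^ 2" for z h
  proof -
    have "\<bar>f (z + h) - f z - dir_deriv h f z\<bar> \<le> M * l1_norm h ^ 2 / 2"
      using Taylor_along_line[OF test_functions_smooth[OF assms] M(2), where r=2 and z=z and t=1 and h=h]
      by (simp add: numeral_2_eq_2 algebra_simps)
    also have "\<dots> \<le> M * l1_norm h ^ 2"
      using M(1) by simp
    also have "\<dots> \<le> M * (real CARD('a) * norm h) ^ 2"
      by (intro mult_left_mono power_mono l1_norm_le M l1_norm_nonneg)
    finally show ?thesis by (simp add: mult_ac power_mult_distrib)
  qed
  with M(1) show ?thesis
    by (intro that[of "M * real CARD('a) ^ 2"]) auto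
qed

section \<open>Convolution\<close>

lemma integrable_compact_support:
  fixes f :: "'a::euclidean_space \<Rightarrow> real"
  assumes "continuous_on UNIV f" "\<And>z. f z \<noteq> 0 \<Longrightarrow> norm z \<le> R"
  shows "integrable lborel f"
proof -
  have "integrable lborel (\<lambda>x. indicator (cball 0 R) x *\<^sub>R f x)"
    using assms(1) by (intro borel_integrable_compact) (auto intro: continuous_on_subset)
  moreover have "(\<lambda>x. indicator (cball 0 R) x *\<^sub>R f x) = f"
    using assms(2) by (force simp: indicator_def)
  ultimately show ?thesis by simp
qed

lemma test_functions_integrable:
  assumes "f \<in> test_functions"
  shows "integrable lborel f"
proof (rule test_functions_bounded_support[OF assms])
  fix R assume "\<And>z. f z \<noteq> 0 \<Longrightarrow> norm z \<le> R"
  with test_functions_continuous[OF assms] show ?thesis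
    by (rule integrable_compact_support)
qed

lemma test_functions_measurable: "f \<in> test_functions \<Longrightarrow> f \<in> borel_measurable borel"
  by (intro borel_measurable_continuous_onI test_functions_continuous)

lemma integral_affine:
  fixes f :: "'a::euclidean_space \<Rightarrow> real"
  assumes [measurable]: "f \<in> borel_measurable borel" and c: "c \<noteq> 0"
  shows "(LINT x|lborel. f x) = \<bar>c\<bar> ^ DIM('a) * (LINT x|lborel. f (t + c *\<^sub>R x))"
  by (subst lborel_affine[OF c, of t]) (simp add: integral_density integral_distr)

definition conv :: "(real ^ 'n \<Rightarrow> real) \<Rightarrow> (real ^ 'n \<Rightarrow> real) \<Rightarrow> (real ^ 'n \<Rightarrow> real)" where
  "conv a f = (\<lambda>z. LINT w|lborel. a w * f (z - w))"

lemma conv_integrable: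
  assumes "a \<in> test_functions" "f \<in> test_functions"
  shows "integrable lborel (\<lambda>w. a w * f (z - w))"
proof -
  obtain R where R: "\<And>z. a z \<noteq> 0 \<Longrightarrow> norm z \<le> R"
    using test_functions_bounded_support[OF assms(1)] by blast
  show ?thesis
    by (intro integrable_compact_support[of _ R] continuous_intros
        continuous_on_compose2[OF test_functions_continuous[OF assms(1)]] 
        continuous_on_compose2[OF test_functions_continuous[OF assms(2)]]) (auto intro: R)
qed

lemma conv_commute:
  assumes "a \<in> test_functions" "f \<in> test_functions"
  shows "conv a f = conv f a"
proof
  fix z
  note [measurable] = assms[THEN test_functions_measurable]
  show "conv a f z = conv f a z"
    unfolding conv_def
    by (subst integral_affine[of _ "-1" z]) (auto simp: mult.commute)
qed

lemma conv_abs_le: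
  assumes "a \<in> test_functions" "f \<in> test_functions" "\<And>z. \<bar>f z\<bar> \<le> M"
  shows "\<bar>conv a f z\<bar> \<le> (LINT w|lborel. \<bar>a w\<bar>) * M"
proof -
  have "\<bar>conv a f z\<bar> \<le> (LINT w|lborel. \<bar>a w * f (z - w)\<bar>)"
    unfolding conv_def by (rule integral_abs_bound)
  also have "\<dots> \<le> (LINT w|lborel. \<bar>a w\<bar> * M)"
    using assms
    by (intro integral_mono integrable_abs conv_integrable integrable_mult_left test_functions_integrable)
      (auto simp: abs_mult mult_left_mono)
  finally show ?thesis by simp
qed

lemma conv_support:
  assumes "conv a f z \<noteq> 0"
  obtains w where "a w \<noteq> 0" "f (z - w) \<noteq> 0"
proof -
  have "\<exists>w. a w * f (z - w) \<noteq> 0"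
  proof (rule ccontr)
    assume "\<not> ?thesis"
    then have "(\<lambda>w. a w * f (z - w)) = (\<lambda>w. 0)" by blast
    then have "conv a f z = 0" by (simp add: conv_def)
    with assms show False by simp
  qed
  then show ?thesis using that by auto
qed

lemma conv_has_derivative:
  assumes a: "a \<in> test_functions" and f: "f \<in> test_functions"
  shows "(conv a f has_derivative (\<lambda>h. \<Sum>i\<in>UNIV. h $ i * conv a (partial_deriv i f) z)) (at z)"
proof -
  obtain L where L: "L \<ge> 0" "\<And>z h. \<bar>f (z + h) - f z - dir_deriv h f z\<bar> \<le> L * norm h ^ 2"
    using test_functions_second_order[OF f] by blast
  let ?D = "\<lambda>h. \<Sum>i\<in>UNIV. h $ i * conv a (partial_deriv i f) z"
  let ?N = "LINT w|lborel. \<bar>a w\<bar>"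
  have bound: "\<bar>conv a f (z + h) - conv a f z - ?D h\<bar> \<le> ?N * L * norm h ^ 2" for h
  proof -
    have iD: "integrable lborel (\<lambda>w. \<Sum>i\<in>UNIV. h $ i * (a w * partial_deriv i f (z - w)))"
      by (intro Bochner_Integration.integrable_sum integrable_mult_right conv_integrable a test_functions_partial_deriv f) 
    have D: "?D h = (LINT w|lborel. (\<Sum>i\<in>UNIV. h $ i * (a w * partial_deriv i f (z - w))))"
      unfolding conv_def
      by (subst Bochner_Integration.integral_sum)
        (auto intro!: integrable_mult_right conv_integrable a test_functions_partial_deriv f)
    have "(LINT w|lborel. a w * (f (z + h - w) - f (z - w) - dir_deriv h f (z - w)))
      = (LINT w|lborel. a w * f (z + h - w) - a w * f (z - w) - 
           (\<Sum>i\<in>UNIV. h $ i * (a w * partial_deriv i f (z - w))))"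
      by (intro Bochner_Integration.integral_cong)
        (auto simp: dir_deriv_def algebra_simps sum_distrib_left)
    also have "\<dots> = conv a f (z + h) - conv a f z - ?D h"
      unfolding D unfolding conv_def using conv_integrable[OF a f] iD by simp
    finally have eq: "conv a f (z + h) - conv a f z - ?D h =
       (LINT w|lborel. a w * (f (z + h - w) - f (z - w) - dir_deriv h f (z - w)))" ..
    have ia: "integrable lborel (\<lambda>w. \<bar>a w\<bar> * (L * norm h ^ 2))"
      by (intro integrable_mult_left integrable_abs test_functions_integrable a)
    have "\<bar>LINT w|lborel. a w * (f (z + h - w) - f (z - w) - dir_deriv h f (z - w))\<bar>
        \<le> (LINT w|lborel. \<bar>a w\<bar> * (L * norm h ^ 2))"
    proof (rule order_trans[OF integral_abs_bound integral_mono'[OF ia]])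
      fix w
      have "\<bar>f (z + h - w) - f (z - w) - dir_deriv h f (z - w)\<bar> \<le> L * norm h ^ 2"
        using L(2)[of "z - w" h] by (simp add: algebra_simps)
      then show "\<bar>a w * (f (z + h - w) - f (z - w) - dir_deriv h f (z - w))\<bar>
          \<le> \<bar>a w\<bar> * (L * norm h ^ 2)"
        by (simp add: abs_mult mult_left_mono)
    qed (use L in simp)
    then show ?thesis
      using eq by (simp add: mult_ac)
  qed
  show ?thesis
  proof (rule has_derivativeI_sandwich[of 1])
    show "bounded_linear ?D"
      by (intro bounded_linear_sum bounded_linear_mult_const bounded_linear_vec_nth)
    show "((\<lambda>y. ?N * L * norm (y - z)) \<longlongrightarrow> 0) (at z)"
      by (rule tendsto_eq_intros | simp)+
    fix y assume "y \<noteq> z"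
    then show "norm (conv a f y - conv a f z - ?D (y - z)) / norm (y - z) \<le> ?N * L * norm (y - z)"
      using bound[of "y - z"] by (simp add: divide_le_eq power2_eq_square mult_ac)
  qed simp
qed

lemma partial_deriv_conv:
  assumes "a \<in> test_functions" "f \<in> test_functions"
  shows "partial_deriv i (conv a f) = conv a (partial_deriv i f)"
  by (rule ext, subst partial_deriv_eqI[OF conv_has_derivative[OF assms]])
    (simp add: axis_def if_distrib if_distribR cong: if_cong)

lemma test_functions_conv:
  assumes "a \<in> test_functions" "f \<in> test_functions"
  shows "conv a f \<in> test_functions"
proof -
  obtain R where R: "\<And>z. a z \<noteq> 0 \<Longrightarrow> norm z \<le> R"
    using test_functions_bounded_support[OF assms(1)] by blast
  obtain S where S: "\<And>z. f z \<noteq> 0 \<Longrightarrow> norm z \<le> S"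
    using test_functions_bounded_support[OF assms(2)] by blast
  show ?thesis
  proof (rule test_functionsI)
    show "smooth (conv a f)"
    proof (rule smooth_coinduct[where P="\<lambda>u. \<exists>f\<in>test_functions. u = conv a f"])
      show "\<exists>f'\<in>test_functions. conv a f = conv a f'"
        using assms by blast
    next
      fix u x assume "\<exists>f\<in>test_functions. u = conv a f"
      then show "u differentiable at x"
        using conv_has_derivative[OF assms(1)] unfolding differentiable_def by blast
    next
      fix u i assume "\<exists>f\<in>test_functions. u = conv a f"
      then show "\<exists>f\<in>test_functions. partial_deriv i u = conv a f"
        using partial_deriv_conv[OF assms(1)] test_functions_partial_deriv by blast
    qed
    fix z assume "conv a f z \<noteq> 0"
    then obtain w where "a w \<noteq> 0" "f (z - w) \<noteq> 0"
      by (rule conv_support)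
    then show "norm z \<le> R + S"
      using R[of w] S[of "z - w"] norm_triangle_ineq[of w "z - w"] by simp
  qed
qed

lemma pders_conv:
  assumes "a \<in> test_functions" "f \<in> test_functions"
  shows "pders js (conv a f) = conv a (pders js f)"
  by (induction js) (simp_all add: partial_deriv_conv[OF assms(1) test_functions_pders[OF assms(2)]])

lemma conv_left_commute:
  assumes a: "a \<in> test_functions" and b: "b \<in> test_functions" and f: "f \<in> test_functions"
  shows "conv a (conv b f) = conv b (conv a f)"
proof
  fix z
  obtain R where R: "\<And>z. a z \<noteq> 0 \<Longrightarrow> norm z \<le> R"
    using test_functions_bounded_support[OF a] by blast
  obtain S where S: "\<And>z. b z \<noteq> 0 \<Longrightarrow> norm z \<le> S"
    using test_functions_bounded_support[OF b] by blast
  have "integrable lborel (\<lambda>(w, v). a w * (b v * f (z - w - v)))"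
  proof (rule integrable_compact_support)
    show "continuous_on UNIV (\<lambda>(w, v). a w * (b v * f (z - w - v)))"
      unfolding case_prod_beta
      by (intro continuous_intros continuous_on_compose2[OF test_functions_continuous[OF a]]
          continuous_on_compose2[OF test_functions_continuous[OF b]]
          continuous_on_compose2[OF test_functions_continuous[OF f]]) auto
    fix p :: "(real ^ 'a) \<times> (real ^ 'a)"
    assume "(case p of (w, v) \<Rightarrow> a w * (b v * f (z - w - v))) \<noteq> 0"
    then show "norm p \<le> R + S"
      using R[of "fst p"] S[of "snd p"] norm_Pair_le[of "fst p" "snd p"]
      by (auto simp: case_prod_beta)
  qed
  then have int: "integrable (lborel \<Otimes>\<^sub>M lborel) (\<lambda>(w, v). a w * (b v * f (z - w - v)))"
    by (simp add: lborel_prod)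
  have "conv a (conv b f) z = (LINT w|lborel. LINT v|lborel. a w * (b v * f (z - w - v)))"
    by (simp add: conv_def)
  also have "\<dots> = (LINT v|lborel. LINT w|lborel. a w * (b v * f (z - w - v)))"
    using lborel_pair.Fubini_integral[OF int] by simp
  also have "\<dots> = (LINT v|lborel. LINT w|lborel. b v * (a w * f (z - v - w)))"
    by (simp add: algebra_simps)
  also have "\<dots> = conv b (conv a f) z"
    by (simp add: conv_def)
  finally show "conv a (conv b f) z = conv b (conv a f) z" .
qed

lemma conv_diff:
  assumes "a \<in> test_functions" "f \<in> test_functions" "g \<in> test_functions"
  shows "conv a (\<lambda>z. f z - g z) = (\<lambda>z. conv a f z - conv a g z)"
  unfolding conv_def
  using conv_integrable[OF assms(1,2)] conv_integrable[OF assms(1,3)] by (simp add: right_diff_distrib)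

lemma conv_sum_left:
  assumes "finite F" "\<And>q. q \<in> F \<Longrightarrow> a q \<in> test_functions" "f \<in> test_functions"
  shows "conv (\<lambda>w. \<Sum>q\<in>F. c q * a q w) f z = (\<Sum>q\<in>F. c q * conv (a q) f z)"
proof -
  have "conv (\<lambda>w. \<Sum>q\<in>F. c q * a q w) f z = (LINT w|lborel. (\<Sum>q\<in>F. c q * (a q w * f (z - w))))"
    by (simp add: conv_def sum_distrib_right sum_distrib_left mult_ac)
  also have "\<dots> = (\<Sum>q\<in>F. LINT w|lborel. c q * (a q w * f (z - w)))"
    by (intro Bochner_Integration.integral_sum integrable_mult_right conv_integrable assms)
  finally show ?thesis by (simp add: conv_def)
qed

lemma conv_rescale:
  assumes a: "a \<in> test_functions" and f: "f \<in> test_functions" and "\<epsilon> > 0"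
  shows "conv (rescale a 0 \<epsilon>) f z = (LINT h|lborel. a h * f (z - \<epsilon> *\<^sub>R h))"
proof -
  note [measurable] = test_functions_measurable[OF a] test_functions_measurable[OF f]
  show ?thesis
    unfolding conv_def rescale_def using \<open>\<epsilon> > 0\<close>
    by (subst integral_affine[of _ \<epsilon> 0]) (auto simp: mult.assoc[symmetric] simp flip: integral_mult_right_zero)
qed

lemma integral_abs_rescale:
  assumes a: "a \<in> test_functions" and "\<epsilon> > 0"
  shows "(LINT w|lborel. \<bar>rescale a x \<epsilon> w\<bar>) = (LINT w|lborel. \<bar>a w\<bar>)"
proof -
  note [measurable] = test_functions_measurable[OF a]
  show ?thesis
    unfolding rescale_def using \<open>\<epsilon> > 0\<close>
    by (subst integral_affine[of _ \<epsilon> x]) (auto simp: abs_mult mult.assoc[symmetric] simp flip: integral_mult_right_zero)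
qed

text \<open>
  The ball is replaced by the cube of side \<open>2 \<rho>\<close> around it, which keeps the constant elementary.
\<close>

lemma integral_abs_le_of_support:
  fixes g :: "real ^ 'n \<Rightarrow> real"
  assumes g: "g \<in> test_functions" and m: "\<And>z. \<bar>g z\<bar> \<le> m"
    and supp: "\<And>z. g z \<noteq> 0 \<Longrightarrow> z \<in> cball x \<rho>" and "\<rho> \<ge> 0"
  shows "(LINT z|lborel. \<bar>g z\<bar>) \<le> m * (2 * \<rho>) ^ CARD('n)"
proof -
  define l u where "l = x - \<rho> *\<^sub>R One" and "u = x + \<rho> *\<^sub>R One"
  have m0: "m \<ge> 0"
    using m[of 0] by linarith
  have sub: "z \<in> cbox l u" if "z \<in> cball x \<rho>" for z
  proof -
    have "\<bar>(x - z) \<bullet> b\<bar> \<le> \<rho>" if "b \<in> Basis" for b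
      using Basis_le_norm[OF that, of "x - z"] \<open>z \<in> cball x \<rho>\<close> by (simp add: dist_norm)
    then have "l \<bullet> b \<le> z \<bullet> b \<and> z \<bullet> b \<le> u \<bullet> b" if "b \<in> Basis" for b
      using that by (simp add: l_def u_def inner_diff_left inner_add_left abs_le_iff) (smt (verit))
    then show ?thesis
      by (simp add: mem_box)
  qed
  have "emeasure lborel (cbox l u) < \<infinity>"
    by (simp add: emeasure_lborel_cbox_eq)
  then have int: "integrable lborel (\<lambda>z. indicator (cbox l u) z * m)"
    by (intro integrable_mult_left) simp
  have "(LINT z|lborel. \<bar>g z\<bar>) \<le> (LINT z|lborel. indicator (cbox l u) z * m)"
    by (rule integral_mono'[OF int]) (use m m0 supp sub in \<open>auto simp: indicator_def\<close>)
  also have "\<dots> = measure lborel (cbox l u) * m"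
    by simp
  also have "measure lborel (cbox l u) = (2 * \<rho>) ^ CARD('n)"
  proof -
    have "l \<bullet> b = x \<bullet> b - \<rho>" "u \<bullet> b = x \<bullet> b + \<rho>" if "b \<in> Basis" for b
      using that by (simp_all add: l_def u_def inner_diff_left inner_add_left)
    then have "(u - l) \<bullet> b = 2 * \<rho>" "l \<bullet> b \<le> u \<bullet> b" if "b \<in> Basis" for b
      using that \<open>\<rho> \<ge> 0\<close> by (simp_all add: inner_diff_left)
    then show ?thesis
      by (simp add: measure_lborel_cbox_eq)
  qed
  finally show ?thesis
    by (simp add: mult.commute)
qed


section \<open>The \<open>C\<^sup>r\<close> norm\<close>

lemma finite_multi_indices: "finite {k :: 'n::finite \<Rightarrow> nat. (\<Sum>i\<in>UNIV. k i) \<le> r}"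
proof (rule finite_subset)
  show "{k :: 'n \<Rightarrow> nat. (\<Sum>i\<in>UNIV. k i) \<le> r} \<subseteq> PiE UNIV (\<lambda>_. {..r})"
  proof
    fix k :: "'n \<Rightarrow> nat" assume "k \<in> {k. (\<Sum>i\<in>UNIV. k i) \<le> r}"
    then have "k i \<le> r" for i
      using member_le_sum[of i UNIV k] by simp
    then show "k \<in> PiE UNIV (\<lambda>_. {..r})"
      by auto
  qed
qed (simp add: finite_PiE)

lemma abs_le_sup_norm:
  assumes "f \<in> test_functions"
  shows "\<bar>f x\<bar> \<le> sup_norm f"
proof (rule test_functions_bounded[OF assms])
  fix M assume "\<And>z. \<bar>f z\<bar> \<le> M"
  then show ?thesis
    unfolding sup_norm_def by (intro cSUP_upper bdd_aboveI2[of _ _ M]) auto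
qed

lemma sup_norm_le: "(\<And>x. \<bar>f x\<bar> \<le> M) \<Longrightarrow> sup_norm f \<le> M"
  unfolding sup_norm_def by (rule cSUP_least) auto

lemma test_functions_multi_deriv: "f \<in> test_functions \<Longrightarrow> multi_deriv k f \<in> test_functions"
  unfolding multi_deriv_eq_pders by (rule test_functions_pders)

lemma abs_pders_le_Cr_norm:
  assumes "f \<in> test_functions" "length js \<le> r"
  shows "\<bar>pders js f x\<bar> \<le> Cr_norm r f"
proof -
  have "count_list js \<in> {k. (\<Sum>i\<in>UNIV. k i) \<le> r}"
    using assms(2) by (simp add: sum_count_list_UNIV)
  then have "sup_norm (multi_deriv (count_list js) f) \<le> Cr_norm r f"
    unfolding Cr_norm_def by (intro Max_ge finite_imageI finite_multi_indices imageI)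
  moreover have "\<bar>multi_deriv (count_list js) f x\<bar> \<le> sup_norm (multi_deriv (count_list js) f)"
    by (intro abs_le_sup_norm test_functions_multi_deriv assms)
  ultimately show ?thesis
    by (simp add: pders_eq_multi_deriv[OF test_functions_smooth[OF assms(1)]])
qed

lemma Cr_norm_le:
  assumes "\<And>js x. length js \<le> r \<Longrightarrow> \<bar>pders js f x\<bar> \<le> M"
  shows "Cr_norm r f \<le> M"
  unfolding Cr_norm_def
proof (rule Max.boundedI)
  show "(\<lambda>k. sup_norm (multi_deriv k f)) ` {k. sum k UNIV \<le> r} \<noteq> {}"
    by (auto intro: exI[of _ "\<lambda>_. 0"])
  fix y assume "y \<in> (\<lambda>k. sup_norm (multi_deriv k f)) ` {k. sum k UNIV \<le> r}"
  then show "y \<le> M"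
    by (auto intro!: sup_norm_le assms simp: multi_deriv_eq_pders length_multi_list)
qed (simp add: finite_multi_indices)

section \<open>Distributions and superpositions of translates\<close>

lemma distribution_add:
  "T \<in> distributions \<Longrightarrow> f \<in> test_functions \<Longrightarrow> g \<in> test_functions \<Longrightarrow> T (\<lambda>z. f z + g z) = T f + T g"
  by (simp add: distributions_def)

lemma distribution_scale:
  "T \<in> distributions \<Longrightarrow> f \<in> test_functions \<Longrightarrow> T (\<lambda>z. c * f z) = c * T f"
  by (simp add: distributions_def)

lemma test_functions_scale: "f \<in> test_functions \<Longrightarrow> (\<lambda>z. c * f z) \<in> test_functions"
  using test_functions_lincomb[OF _ test_functions_zero, of f c 0] by simp

lemma distribution_diff:
  assumes "T \<in> distributions" "f \<in> test_functions" "g \<in> test_functions"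
  shows "T (\<lambda>z. f z - g z) = T f - T g"
  using distribution_add[OF assms(1,2) test_functions_scale[OF assms(3), of "-1"]]
    distribution_scale[OF assms(1,3), of "-1"] by simp

lemma distribution_sum:
  assumes "T \<in> distributions" "finite F" "\<And>q. q \<in> F \<Longrightarrow> f q \<in> test_functions"
  shows "T (\<lambda>z. \<Sum>q\<in>F. w q * f q z) = (\<Sum>q\<in>F. w q * T (f q))"
  using assms(2,3)
proof (induction F rule: finite_induct)
  case empty
  then show ?case
    using distribution_scale[OF assms(1) test_functions_zero, of 0] by simp
next
  case (insert q F)
  then show ?case
    using distribution_add[OF assms(1) test_functions_scale[of "f q" "w q"] test_functions_sum[of F f w]]
      distribution_scale[OF assms(1), of "f q" "w q"] by simp
qed

text \<open>
  Sequential continuity: the supports stay in one compact set and every derivative tends to \<open>0\<close>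
  uniformly. The order of \<open>T\<close> on \<open>K\<close> is unknown, so all derivatives have to be controlled.
\<close>

lemma distribution_tendsto_0:
  fixes T :: "(real ^ 'n::finite \<Rightarrow> real) \<Rightarrow> real"
  assumes T: "T \<in> distributions" and K: "compact K" and g: "\<And>n. g n \<in> test_functions_in K"
    and lim: "\<And>js. \<exists>s. s \<longlonglongrightarrow> 0 \<and> (\<forall>n z. \<bar>pders js (g n) z\<bar> \<le> s n)"
  shows "(\<lambda>n. T (g n)) \<longlonglongrightarrow> 0"
proof -
  have "\<exists>r C. \<forall>\<phi>\<in>test_functions_in K. \<bar>T \<phi>\<bar> \<le> C * Cr_norm r \<phi>"
    using T K by (simp add: distributions_def)
  then obtain r C where C: "\<forall>\<phi>\<in>test_functions_in K. \<bar>T \<phi>\<bar> \<le> C * Cr_norm r \<phi>"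
    by blast
  have "\<forall>js. \<exists>s. s \<longlonglongrightarrow> 0 \<and> (\<forall>n z. \<bar>pders js (g n) z\<bar> \<le> s n)"
    using lim by blast
  from choice[OF this] obtain s
    where "\<forall>js. s js \<longlonglongrightarrow> 0 \<and> (\<forall>n z. \<bar>pders js (g n) z\<bar> \<le> s js n)"
    by blast
  then have s: "\<And>js. s js \<longlonglongrightarrow> 0" "\<And>js n z. \<bar>pders js (g n) z\<bar> \<le> s js n"
    by auto
  have g': "g n \<in> test_functions" for n
    using g by (simp add: test_functions_in_def)
  let ?J = "{js :: 'n list. set js \<subseteq> UNIV \<and> length js \<le> r}"
  have fin: "finite ?J"
    by (rule finite_lists_length_le) simp
  have s0: "s js n \<ge> 0" for js n
    using s(2)[where z=0] by (rule order_trans[rotated]) simp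
  have Cr: "Cr_norm r (g n) \<le> (\<Sum>js\<in>?J. s js n)" for n
  proof (rule Cr_norm_le)
    fix js :: "'n list" and x assume "length js \<le> r"
    then have "s js n \<le> (\<Sum>js\<in>?J. s js n)"
      using fin s0 by (intro member_le_sum) auto
    with s(2)[of js n x] show "\<bar>pders js (g n) x\<bar> \<le> (\<Sum>js\<in>?J. s js n)"
      by simp
  qed
  show ?thesis
  proof (rule Lim_null_comparison)
    show "(\<lambda>n. \<bar>C\<bar> * (\<Sum>js\<in>?J. s js n)) \<longlonglongrightarrow> 0"
      by (intro tendsto_mult_right_zero tendsto_null_sum s)
    show "\<forall>\<^sub>F n in sequentially. norm (T (g n)) \<le> \<bar>C\<bar> * (\<Sum>js\<in>?J. s js n)"
    proof (intro always_eventually allI)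
      fix n
      have "0 \<le> Cr_norm r (g n)"
        using abs_pders_le_Cr_norm[OF g', of "[]" r n 0] by simp
      then have "C * Cr_norm r (g n) \<le> \<bar>C\<bar> * (\<Sum>js\<in>?J. s js n)"
        by (intro mult_mono Cr) auto
      then show "norm (T (g n)) \<le> \<bar>C\<bar> * (\<Sum>js\<in>?J. s js n)"
        using bspec[OF C g, of n] by simp
    qed
  qed
qed

text \<open>
  Turns a finite cover by small balls into a partition; the second
  property states disjointness and exhaustion at once, in the form in which integrals split.
\<close>

lemma disjoint_refinement:
  assumes "finite F" "A \<in> sets borel" "A \<subseteq> (\<Union>q\<in>F. ball q \<delta>)"
  shows "\<exists>D. (\<forall>q\<in>F. D q \<in> sets borel \<and> D q \<subseteq> ball q \<delta>) \<and>
    (\<forall>y. (\<Sum>q\<in>F. indicator (D q) y) = (indicator A y :: real))"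
  using assms
proof (induction F arbitrary: A rule: finite_induct)
  case (insert q F)
  have "A - ball q \<delta> \<in> sets borel" "A - ball q \<delta> \<subseteq> (\<Union>q\<in>F. ball q \<delta>)"
    using insert.prems by auto
  from insert.IH[OF this] obtain D where
    D: "\<And>p. p \<in> F \<Longrightarrow> D p \<in> sets borel \<and> D p \<subseteq> ball p \<delta>"
       "\<And>y. (\<Sum>p\<in>F. indicator (D p) y) = (indicator (A - ball q \<delta>) y :: real)"
    by blast
  let ?D = "D(q := A \<inter> ball q \<delta>)"
  have eq: "(\<Sum>p\<in>F. indicator (?D p) y) = (\<Sum>p\<in>F. indicator (D p) y :: real)" for y
    using insert.hyps by (intro sum.cong) auto
  have "(\<Sum>p\<in>insert q F. indicator (?D p) y) = (indicator A y :: real)" for y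
    unfolding sum.insert[OF insert.hyps] eq D(2) by (simp add: indicator_def)
  then show ?case
    using D(1) insert.prems insert.hyps by (intro exI[of _ ?D]) auto
qed auto

text \<open>
  Formally \<open>T (g * f) = \<integral> g(y) T (f(\<cdot> - y)) dy\<close>. The proof replaces the convolution by Riemann sums
  \<open>\<Sum>\<^sub>q w\<^sub>q f(\<cdot> - q)\<close>, where \<open>w\<^sub>q\<close> is the integral of \<open>g\<close> over the cell of \<open>q\<close>. On such a finite sum the
  bound is linearity. The Riemann sums converge with all derivatives, because
  test functions are Lipschitz and differentiation commutes with convolution.
\<close>

lemma distribution_superposition:
  fixes T :: "(real ^ 'n::finite \<Rightarrow> real) \<Rightarrow> real"
  assumes T: "T \<in> distributions" and g: "g \<in> test_functions" and f: "f \<in> test_functions"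
    and supp: "\<And>y. g y \<noteq> 0 \<Longrightarrow> y \<in> cball x \<rho>"
    and B: "\<And>y. y \<in> cball x \<rho> \<Longrightarrow> \<bar>T (\<lambda>z. f (z - y))\<bar> \<le> B"
  shows "\<bar>T (conv g f)\<bar> \<le> B * (LINT y|lborel. \<bar>g y\<bar>)"
proof -
  define A where "A = cball x \<rho>"
  let ?N = "LINT y|lborel. \<bar>g y\<bar>"
  have gi: "integrable lborel (\<lambda>y. \<bar>g y\<bar>)"
    by (intro integrable_abs test_functions_integrable g)
  note [measurable] = test_functions_measurable[OF g]
  have "\<exists>F D. finite F \<and> F \<subseteq> A \<and> (\<forall>q\<in>F. D q \<in> sets borel \<and> D q \<subseteq> ball q (inverse (real (Suc n)))) \<and>
    (\<forall>y. (\<Sum>q\<in>F. indicator (D q) y) = (indicator A y :: real))" for n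
  proof -
    have "compact A" by (simp add: A_def)
    then obtain F where "finite F" "F \<subseteq> A" "A \<subseteq> (\<Union>q\<in>F. ball q (inverse (real (Suc n))))"
      by (rule compactE_image[of A A "\<lambda>q. ball q (inverse (real (Suc n)))"]) auto
    then show ?thesis
      using disjoint_refinement[of F A "inverse (real (Suc n))"] by (auto simp: A_def)
  qed
  then obtain F D where F: "\<And>n. finite (F n)" "\<And>n. F n \<subseteq> A"
    and D: "\<And>n q. q \<in> F n \<Longrightarrow> D n q \<in> sets borel" "\<And>n q. q \<in> F n \<Longrightarrow> D n q \<subseteq> ball q (inverse (real (Suc n)))"
    and ind: "\<And>n y. (\<Sum>q\<in>F n. indicator (D n q) y) = (indicator A y :: real)"
    by metis
  define w where "w n q = (LINT y|lborel. indicator (D n q) y * g y)" for n q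
  have iD: "integrable lborel (\<lambda>y. indicator (D n q) y * u y)" 
    if "q \<in> F n" "integrable lborel u" for u :: "_ \<Rightarrow> real" and n q
    using integrable_real_mult_indicator[of "D n q" lborel u] D(1)[OF that(1)] that(2)
    by (simp add: mult.commute)
  have split: "(LINT y|lborel. u y) = (\<Sum>q\<in>F n. LINT y|lborel. indicator (D n q) y * u y)"
    if "integrable lborel u" "\<And>y. y \<notin> A \<Longrightarrow> u y = 0" for u :: "_ \<Rightarrow> real" and n
  proof -
    have "u y = (\<Sum>q\<in>F n. indicator (D n q) y * u y)" for y
    proof -
      have "u y = (\<Sum>q\<in>F n. indicator (D n q) y) * u y"
        unfolding ind using that(2)[of y] by (cases "y \<in> A") auto
      then show ?thesis
        by (simp only: sum_distrib_right)
    qed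
    then have "(LINT y|lborel. u y) = (LINT y|lborel. (\<Sum>q\<in>F n. indicator (D n q) y * u y))"
      by (rule arg_cong[OF ext])
    also have "\<dots> = (\<Sum>q\<in>F n. LINT y|lborel. indicator (D n q) y * u y)"
      by (intro Bochner_Integration.integral_sum iD that)
    finally show ?thesis .
  qed
  have g0: "g y = 0" if "y \<notin> A" for y
    using supp that unfolding A_def by blast
  define R where "R n = (\<lambda>z. \<Sum>q\<in>F n. w n q * f (z - q))" for n
  have R_test: "R n \<in> test_functions" for n
    unfolding R_def by (intro test_functions_sum test_functions_translate f F)
  have pR: "pders js (R n) z = (\<Sum>q\<in>F n. w n q * pders js f (z - q))" for js n z
    unfolding R_def
    by (subst pders_sum) (auto intro: F test_functions_smooth test_functions_translate f
        simp: pders_translate test_functions_smooth[OF f])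
  have TR: "\<bar>T (R n)\<bar> \<le> B * ?N" for n
  proof -
    have "T (R n) = (\<Sum>q\<in>F n. w n q * T (\<lambda>z. f (z - q)))"
      unfolding R_def by (intro distribution_sum T F test_functions_translate f)
    also have "\<bar>\<dots>\<bar> \<le> (\<Sum>q\<in>F n. (LINT y|lborel. indicator (D n q) y * \<bar>g y\<bar>) * B)"
    proof (rule order_trans[OF sum_abs], rule sum_mono)
      fix q assume q: "q \<in> F n"
      have "\<bar>w n q\<bar> \<le> (LINT y|lborel. \<bar>indicator (D n q) y * g y\<bar>)"
        unfolding w_def by (rule integral_abs_bound)
      then have "\<bar>w n q\<bar> \<le> (LINT y|lborel. indicator (D n q) y * \<bar>g y\<bar>)"
        by (simp add: abs_mult)
      moreover have "\<bar>T (\<lambda>z. f (z - q))\<bar> \<le> B"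
        using q F(2)[of n] by (intro B) (auto simp: A_def)
      ultimately show "\<bar>w n q * T (\<lambda>z. f (z - q))\<bar> \<le> (LINT y|lborel. indicator (D n q) y * \<bar>g y\<bar>) * B"
        unfolding abs_mult by (intro mult_mono) (auto intro!: integral_nonneg_AE)
    qed
    also have "\<dots> = B * ?N"
      using split[OF gi, of n] g0 by (simp add: sum_distrib_left mult.commute)
    finally show ?thesis .
  qed
  obtain Rg where Rg: "\<And>z. g z \<noteq> 0 \<Longrightarrow> norm z \<le> Rg"
    using test_functions_bounded_support[OF g] by blast
  obtain Rf where Rf: "\<And>z. f z \<noteq> 0 \<Longrightarrow> norm z \<le> Rf"
    using test_functions_bounded_support[OF f] by blast
  let ?e = "\<lambda>n z. conv g f z - R n z"
  have "(\<lambda>n. T (?e n)) \<longlonglongrightarrow> 0"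
  proof (rule distribution_tendsto_0[OF T])
    let ?K = "cball (0 :: real ^ 'n) (max (Rg + Rf) (norm x + \<rho> + Rf))"
    show "compact ?K" by simp
    show "?e n \<in> test_functions_in ?K" for n
    proof (rule test_functions_inI)
      show "?e n \<in> test_functions"
        by (intro test_functions_diff test_functions_conv g f R_test)
      show "closed ?K" by simp
      fix z assume "?e n z \<noteq> 0"
      then consider "conv g f z \<noteq> 0" | "R n z \<noteq> 0" by fastforce
      then show "z \<in> ?K"
      proof cases
        case 1
        then obtain v where "g v \<noteq> 0" "f (z - v) \<noteq> 0" by (rule conv_support)
        then show ?thesis
          using Rg[of v] Rf[of "z - v"] norm_triangle_ineq[of v "z - v"] by simp
      next
        case 2
        then obtain q where "q \<in> F n" "w n q * f (z - q) \<noteq> 0"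
          unfolding R_def by (rule sum.not_neutral_contains_not_neutral)
        then have q: "q \<in> F n" "f (z - q) \<noteq> 0"
          by auto
        have "dist x q \<le> \<rho>"
          using subsetD[OF F(2) q(1)] by (simp add: A_def)
        then have "norm q \<le> norm x + \<rho>"
          using norm_triangle_ineq2[of q x] by (simp add: dist_norm norm_minus_commute)
        then show ?thesis
          using Rf[OF q(2)] norm_triangle_ineq[of q "z - q"] by simp
      qed
    qed
    fix js :: "'n list"
    let ?f = "pders js f"
    have ft: "?f \<in> test_functions" by (rule test_functions_pders[OF f])
    obtain L where L: "L \<ge> 0" "\<And>x y. \<bar>?f x - ?f y\<bar> \<le> L * norm (x - y)"
      using test_functions_Lipschitz[OF ft] by blast
    have "\<bar>pders js (?e n) z\<bar> \<le> L * ?N * inverse (real (Suc n))" for n z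
    proof -
      let ?d = "inverse (real (Suc n))"
      have "pders js (?e n) z = pders js (conv g f) z - pders js (R n) z"
        using pders_lincomb[OF test_functions_smooth[OF test_functions_conv[OF g f]]
          test_functions_smooth[OF R_test], of js 1 "-1" n] by simp
      also have "\<dots> = conv g ?f z - (\<Sum>q\<in>F n. w n q * ?f (z - q))"
        by (simp add: pR pders_conv[OF g f])
      also have "conv g ?f z = (\<Sum>q\<in>F n. LINT y|lborel. indicator (D n q) y * (g y * ?f (z - y)))"
        unfolding conv_def by (intro split conv_integrable g ft) (simp add: g0)
      also have "(\<Sum>q\<in>F n. w n q * ?f (z - q)) =
          (\<Sum>q\<in>F n. LINT y|lborel. indicator (D n q) y * (g y * ?f (z - q)))"
        unfolding w_def by (simp flip: mult.assoc)
      also have "(\<Sum>q\<in>F n. LINT y|lborel. indicator (D n q) y * (g y * ?f (z - y))) - \<dots>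
         = (\<Sum>q\<in>F n. LINT y|lborel. indicator (D n q) y * (g y * (?f (z - y) - ?f (z - q))))"
        unfolding sum_subtractf[symmetric]
      proof (rule sum.cong[OF refl])
        fix q assume q: "q \<in> F n"
        show "(LINT y|lborel. indicator (D n q) y * (g y * ?f (z - y))) - 
            (LINT y|lborel. indicator (D n q) y * (g y * ?f (z - q)))
          = (LINT y|lborel. indicator (D n q) y * (g y * (?f (z - y) - ?f (z - q))))"
          using iD[OF q conv_integrable[OF g ft, of z]] 
            iD[OF q integrable_mult_left[OF test_functions_integrable[OF g], of "?f (z - q)"]]
          by (simp add: right_diff_distrib)
      qed
      also have "\<bar>\<dots>\<bar> \<le> (\<Sum>q\<in>F n. LINT y|lborel. indicator (D n q) y * (\<bar>g y\<bar> * (L * ?d)))"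
      proof (rule order_trans[OF sum_abs], rule sum_mono, rule order_trans[OF integral_abs_bound])
        fix q assume q: "q \<in> F n"
        show "(LINT y|lborel. \<bar>indicator (D n q) y * (g y * (?f (z - y) - ?f (z - q)))\<bar>)
          \<le> (LINT y|lborel. indicator (D n q) y * (\<bar>g y\<bar> * (L * ?d)))"
        proof (rule integral_mono'[OF iD[OF q integrable_mult_left[OF gi]]])
          fix y
          show "\<bar>indicator (D n q) y * (g y * (?f (z - y) - ?f (z - q)))\<bar>
            \<le> indicator (D n q) y * (\<bar>g y\<bar> * (L * ?d))"
          proof (cases "y \<in> D n q")
            case True
            then have "norm (q - y) \<le> ?d"
              using D(2)[OF q] by (force simp: dist_norm)
            then have "\<bar>?f (z - y) - ?f (z - q)\<bar> \<le> L * ?d"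
              using L(2)[of "z - y" "z - q"] mult_left_mono[OF _ L(1), of "norm (q - y)" ?d] by simp
            then show ?thesis
              using True by (simp add: abs_mult mult_left_mono)
          qed simp
        qed (use L in simp)
      qed
      also have "\<dots> = (LINT y|lborel. \<bar>g y\<bar> * (L * ?d))"
        by (rule split[symmetric]) (use gi g0 in auto)
      finally show ?thesis
        by (simp add: mult_ac)
    qed
    moreover have "(\<lambda>n. L * ?N * inverse (real (Suc n))) \<longlonglongrightarrow> 0"
      by (intro tendsto_mult_right_zero LIMSEQ_inverse_real_of_nat)
    ultimately show "\<exists>s. s \<longlonglongrightarrow> 0 \<and> (\<forall>n z. \<bar>pders js (?e n) z\<bar> \<le> s n)"
      by blast
  qed
  then have "(\<lambda>n. \<bar>T (?e n)\<bar> + B * ?N) \<longlonglongrightarrow> \<bar>0\<bar> + B * ?N"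
    by (intro tendsto_intros)
  moreover have "\<bar>T (conv g f)\<bar> \<le> \<bar>T (?e n)\<bar> + B * ?N" for n
    using TR[of n] distribution_diff[OF T test_functions_conv[OF g f] R_test, of n] by linarith
  ultimately show ?thesis
    by (intro LIMSEQ_le_const[where X="\<lambda>n. \<bar>T (?e n)\<bar> + B * ?N"]) auto
qed

section \<open>Extrapolation to zero and numerical bounds\<close>

text \<open>
  The value at \<open>0\<close> of the Lagrange basis polynomial that is \<open>1\<close> at the node \<open>l i\<close> and \<open>0\<close> at the other
  nodes.
\<close>

definition extrapolation_weight :: "nat \<Rightarrow> (nat \<Rightarrow> real) \<Rightarrow> nat \<Rightarrow> real" where
  "extrapolation_weight r l i = (\<Prod>k\<in>{..<r} - {i}. l k / (l k - l i))"

text \<open>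
  Lagrange interpolation is exact on the monomial of degree \<open>m < r\<close>; both sides are its
  value at \<open>0\<close>.
\<close>

lemma extrapolation_weight_sum:
  assumes inj: "inj_on l {..<r}" and m: "m < r"
  shows "(\<Sum>i<r. extrapolation_weight r l i * l i ^ m) = 0 ^ m"
proof -
  define P where "P = (\<Sum>i<r. smult (l i ^ m) (\<Prod>k\<in>{..<r} - {i}. smult (1 / (l i - l k)) [:- l k, 1:]))"
  have "degree (\<Prod>k\<in>{..<r} - {i}. smult (1 / (l i - l k)) [:- l k, 1:]) < r" if "i < r" for i
  proof -
    have "degree (\<Prod>k\<in>{..<r} - {i}. smult (1 / (l i - l k)) [:- l k, 1:])
       \<le> (\<Sum>k\<in>{..<r} - {i}. degree (smult (1 / (l i - l k)) [:- l k, 1:]))"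
      using degree_prod_sum_le[of "{..<r} - {i}" "\<lambda>k. smult (1 / (l i - l k)) [:- l k, 1:]"]
      by (simp add: o_def)
    also have "\<dots> \<le> (\<Sum>k\<in>{..<r} - {i}. 1)"
      by (intro sum_mono) (use degree_smult_le in auto)
    also have "\<dots> < r"
      using that by simp
    finally show ?thesis .
  qed
  then have "degree P < r"
    unfolding P_def using m
    by (intro degree_sum_less) (auto intro: le_less_trans[OF degree_smult_le])
  moreover have "poly P (l j) = l j ^ m" if "j < r" for j
  proof -
    have "poly P (l j) = (\<Sum>i<r. l i ^ m * (\<Prod>k\<in>{..<r} - {i}. (l j - l k) / (l i - l k)))"
      by (simp add: P_def poly_sum poly_prod diff_divide_distrib)
    also have "\<dots> = (\<Sum>i<r. if i = j then l j ^ m else 0)"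
    proof (rule sum.cong[OF refl])
      fix i assume i: "i \<in> {..<r}"
      show "l i ^ m * (\<Prod>k\<in>{..<r} - {i}. (l j - l k) / (l i - l k)) = (if i = j then l j ^ m else 0)"
      proof (cases "i = j")
        case True
        have "(\<Prod>k\<in>{..<r} - {i}. (l j - l k) / (l i - l k)) = 1"
          using True i inj by (intro prod.neutral) (auto simp: inj_on_def)
        then show ?thesis using True by simp
      next
        case False
        then have "(\<Prod>k\<in>{..<r} - {i}. (l j - l k) / (l i - l k)) = 0"
          using that by (intro prod_zero) auto
        then show ?thesis using False by simp
      qed
    qed
    also have "\<dots> = l j ^ m"
      using that by simp
    finally show ?thesis .
  qed
  moreover have "card (l ` {..<r}) = r"
    using card_image[OF inj] by simp
  ultimately have "P = monom 1 m"
    using m by (intro poly_eqI_degree[of "l ` {..<r}"]) (auto simp: poly_monom degree_monom_eq)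
  then have "poly P 0 = 0 ^ m"
    by (simp add: poly_monom)
  moreover have "poly P 0 = (\<Sum>i<r. extrapolation_weight r l i * l i ^ m)"
  proof -
    have "- l k / (l i - l k) = l k / (l k - l i)" for i k
      by (metis minus_diff_eq minus_divide_divide minus_minus)
    then show ?thesis
      by (simp add: P_def poly_sum poly_prod extrapolation_weight_def mult.commute)
  qed
  ultimately show ?thesis by simp
qed

lemma inverse_one_minus_le_exp:
  assumes "0 \<le> x" "x \<le> 1 / 2"
  shows "1 / (1 - x) \<le> exp (2 * x :: real)"
proof -
  have "x * (1 - 2 * x) \<ge> 0"
    using assms by simp
  then have "1 \<le> (1 + 2 * x) * (1 - x)"
    by (simp add: algebra_simps)
  also have "\<dots> \<le> exp (2 * x) * (1 - x)"
    using assms by (intro mult_right_mono exp_ge_add_one_self) auto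
  finally show ?thesis
    using assms by (simp add: divide_le_eq)
qed

text \<open>
  The factors of the product are \<open>1 / (1 - 2\<^bsup>k-i\<^esup>)\<close>. Those with \<open>k > i\<close> are at most \<open>1\<close> in absolute
  value; those with \<open>k < i\<close> are at most \<open>exp (2 \<cdot> 2\<^bsup>k-i\<^esup>)\<close>, and the exponents form a geometric
  series with sum at most \<open>2\<close>. Hence the bound depends neither on \<open>r\<close> nor on \<open>i\<close>.
\<close>

lemma abs_extrapolation_weight_le:
  assumes "s > 0"
  shows "\<bar>extrapolation_weight r (\<lambda>i. s / 2 ^ i) i\<bar> \<le> exp 2"
proof -
  define a where "a k = (if k < i then 2 * (1 / 2) ^ (i - k) else 0 :: real)" for k
  have quot: "u / (u - u * x) = 1 / (1 - x)" if "u \<noteq> 0" for u x :: real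
    using mult_divide_mult_cancel_left[OF that, of 1 "1 - x"] by (simp add: right_diff_distrib)
  have "\<bar>(s / 2 ^ k) / (s / 2 ^ k - s / 2 ^ i)\<bar> \<le> exp (a k)" if "k \<noteq> i" for k
  proof (cases "k < i")
    case True
    then obtain m where m: "i = k + Suc m" using less_imp_Suc_add by auto
    have x: "(1 / 2) ^ Suc m \<le> (1 / 2 :: real)"
      using power_le_one[of "1 / 2 :: real" m] by simp
    have "s / 2 ^ i = s / 2 ^ k * (1 / 2) ^ Suc m"
      by (simp add: m power_add power_one_over)
    then have eq: "(s / 2 ^ k) / (s / 2 ^ k - s / 2 ^ i) = 1 / (1 - (1 / 2) ^ Suc m)"
      using quot[of "s / 2 ^ k" "(1 / 2) ^ Suc m"] assms by simp
    have "1 / (1 - (1 / 2) ^ Suc m) \<le> exp (2 * (1 / 2 :: real) ^ Suc m)"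
      by (rule inverse_one_minus_le_exp) (use x in auto)
    moreover have "1 / (1 - (1 / 2) ^ Suc m) \<ge> (0 :: real)"
      using x by simp
    ultimately have "\<bar>(s / 2 ^ k) / (s / 2 ^ k - s / 2 ^ i)\<bar> \<le> exp (2 * (1 / 2) ^ Suc m)"
      unfolding eq by (simp only: abs_of_nonneg)
    moreover have "a k = 2 * (1 / 2) ^ Suc m"
      by (simp add: a_def m)
    ultimately show ?thesis
      by (simp only:)
  next
    case False
    with that obtain m where m: "k = i + Suc m" using less_imp_Suc_add[of i k] by auto
    have x: "(1::real) \<le> \<bar>1 - 2 ^ Suc m\<bar>"
      unfolding power_Suc using one_le_power[of "2 :: real" m] by linarith
    have "s / 2 ^ i = s / 2 ^ k * 2 ^ Suc m"
      by (simp add: m power_add)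
    then have "(s / 2 ^ k) / (s / 2 ^ k - s / 2 ^ i) = 1 / (1 - 2 ^ Suc m)"
      using quot[of "s / 2 ^ k" "2 ^ Suc m"] assms by simp
    also have "\<bar>\<dots>\<bar> \<le> 1"
      unfolding abs_divide using x by (subst divide_le_eq_1) auto
    finally show ?thesis
      using False by (simp add: a_def)
  qed
  then have "\<bar>extrapolation_weight r (\<lambda>i. s / 2 ^ i) i\<bar> \<le> (\<Prod>k\<in>{..<r} - {i}. exp (a k))"
    unfolding extrapolation_weight_def abs_prod by (intro prod_mono) auto
  also have "\<dots> = exp (\<Sum>k\<in>{..<r} - {i}. a k)"
    by (simp add: exp_sum)
  also have "(\<Sum>k\<in>{..<r} - {i}. a k) \<le> (\<Sum>k\<in>{..<i} \<union> ({..<r} - {i}). a k)"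
    by (rule sum_mono2) (auto simp: a_def)
  also have "\<dots> = (\<Sum>k<i. a k)"
    by (rule sum.mono_neutral_right) (auto simp: a_def)
  also have "(\<Sum>k<i. a k) = (\<Sum>k<i. 2 * (1 / 2) ^ (i - k))"
    by (simp add: a_def)
  also have "(\<Sum>k<i. 2 * (1 / 2) ^ (i - k)) \<le> (2 :: real)"
  proof (induction i)
    case (Suc i)
    have "(\<Sum>k<Suc i. 2 * (1 / 2) ^ (Suc i - k)) = (1 / 2) * (\<Sum>k<i. 2 * (1 / 2) ^ (i - k)) + (1 :: real)"
      by (simp add: Suc_diff_le sum_distrib_left)
    with Suc.IH show ?case by linarith
  qed simp
  finally show ?thesis by simp
qed

lemma power_div_fact_le_exp:
  fixes x :: real
  assumes "x \<ge> 0"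
  shows "x ^ n / fact n \<le> exp x"
proof -
  have "(\<Sum>k\<in>{n}. x ^ k /\<^sub>R fact k) \<le> (\<Sum>k. x ^ k /\<^sub>R fact k)"
    by (rule sum_le_suminf[OF summable_exp_generic]) (use assms in auto)
  then show ?thesis
    by (simp add: exp_def divide_inverse mult.commute)
qed

text \<open>
  The first factor bounds a volume, the second one collects the first term of the telescoping
  series and the Taylor remainders of the others.
\<close>

lemma dimension_constant_le:
  "(5 / 2) ^ d * (1 + 2 * ((real d / 4) ^ r / fact r)) \<le> 4 ^ (d + 1)"
proof -
  have "(real d / 4) ^ r / fact r \<le> exp (real d / 4)"
    by (rule power_div_fact_le_exp) simp
  also have "\<dots> = exp (1 / 4) ^ d"
    by (simp flip: exp_of_nat_mult)
  also have "\<dots> \<le> (8 / 5) ^ d"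
    using exp_bound[of "1 / 4"] by (intro power_mono) (auto simp: power2_eq_square)
  finally have "1 + 2 * ((real d / 4) ^ r / fact r) \<le> 4 * (8 / 5) ^ d"
    using one_le_power[of "8 / 5 :: real" d] by linarith
  then have "(5 / 2) ^ d * (1 + 2 * ((real d / 4) ^ r / fact r)) \<le> (5 / 2) ^ d * (4 * (8 / 5) ^ d)"
    by (intro mult_left_mono) auto
  also have "\<dots> = 4 ^ (d + 1)"
    by (simp flip: power_mult_distrib)
  finally show ?thesis .
qed


section \<open>Kernels reproducing polynomials\<close>

lemma test_ball_rescale:
  fixes \<psi> :: "real ^ 'n::finite \<Rightarrow> real"
  assumes \<psi>: "\<psi> \<in> test_ball r" and "\<mu> > 0"
  shows "rescale \<psi> x \<mu> \<in> test_functions"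
    and "length js \<le> r \<Longrightarrow> \<bar>pders js (rescale \<psi> x \<mu>) z\<bar> \<le> inverse (\<mu> ^ CARD('n)) * inverse \<mu> ^ length js"
    and "rescale \<psi> x \<mu> z \<noteq> 0 \<Longrightarrow> z \<in> cball x \<mu>"
proof -
  have t: "\<psi> \<in> test_functions" and s: "supp \<psi> \<subseteq> cball 0 1" and C: "Cr_norm r \<psi> \<le> 1"
    using \<psi> by (auto simp: test_ball_def test_functions_in_def)
  show "rescale \<psi> x \<mu> \<in> test_functions"
    using test_functions_rescale[OF t] \<open>\<mu> > 0\<close> by simp
  show "\<bar>pders js (rescale \<psi> x \<mu>) z\<bar> \<le> inverse (\<mu> ^ CARD('n)) * inverse \<mu> ^ length js" if "length js \<le> r"
  proof -
    have "\<bar>pders js \<psi> (inverse \<mu> *\<^sub>R (z - x))\<bar> \<le> 1"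
      using abs_pders_le_Cr_norm[OF t that] C by (rule order_trans)
    then have "(inverse (\<mu> ^ CARD('n)) * inverse \<mu> ^ length js) * \<bar>pders js \<psi> (inverse \<mu> *\<^sub>R (z - x))\<bar>
       \<le> (inverse (\<mu> ^ CARD('n)) * inverse \<mu> ^ length js) * 1"
      using \<open>\<mu> > 0\<close> by (intro mult_left_mono) auto
    then show ?thesis
      using \<open>\<mu> > 0\<close> unfolding rescale_def
      by (subst pders_affine[OF test_functions_smooth[OF t]]) (simp add: abs_mult)
  qed
  show "z \<in> cball x \<mu>" if "rescale \<psi> x \<mu> z \<noteq> 0"
  proof -
    have "\<psi> (inverse \<mu> *\<^sub>R (z - x)) \<noteq> 0"
      using that by (simp add: rescale_def)
    then have "inverse \<mu> *\<^sub>R (z - x) \<in> cball 0 1"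
      using s supp_memI by blast
    then have "inverse \<mu> * norm (z - x) \<le> 1"
      using \<open>\<mu> > 0\<close> by simp
    then have "norm (z - x) \<le> \<mu>"
      using \<open>\<mu> > 0\<close> by (simp add: field_simps)
    then show ?thesis
      by (simp add: dist_norm norm_minus_commute)
  qed
qed

text \<open>
  The combination \<open>f \<mapsto> \<Sum>\<^sub>i c\<^sub>i \<integral> \<phi>(h) f(\<cdot> - l\<^sub>i h) dh\<close> fixes all polynomials of degree less than \<open>r\<close>. The
  moment of order \<open>m\<close> of a rescaled copy is that of \<open>\<phi>\<close> times \<open>l\<^sub>i\<^sup>m\<close>, so this reduces to the
  sums \<open>\<Sum>\<^sub>i c\<^sub>i l\<^sub>i\<^sup>m\<close>. The radius \<open>1/8\<close> leads to the numbers in \<open>dimension_constant_le\<close>.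
\<close>

locale reproducing_combination =
  fixes \<phi> :: "real ^ 'n::finite \<Rightarrow> real" and c l :: "nat \<Rightarrow> real" and r :: nat
  assumes test: "\<phi> \<in> test_functions"
    and r_pos: "r > 0"
    and l_pos: "\<And>i. i < r \<Longrightarrow> l i > 0"
    and moments: "\<And>m. m < r \<Longrightarrow> (\<Sum>i<r. c i * l i ^ m) * (LINT z|lborel. \<phi> z) = 0 ^ m"
    and small: "\<And>i z. i < r \<Longrightarrow> \<phi> z \<noteq> 0 \<Longrightarrow> l i * norm z \<le> 1 / 8"
begin

definition kernel :: "real \<Rightarrow> real ^ 'n \<Rightarrow> real" where
  "kernel \<epsilon> = (\<lambda>w. \<Sum>i<r. c i * rescale \<phi> 0 (l i * \<epsilon>) w)"

text \<open>
  An upper bound for the \<open>L\<^sup>1\<close> norm of \<open>kernel \<epsilon>\<close> at every scale.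
\<close>

definition mass :: real where
  "mass = (\<Sum>i<r. \<bar>c i\<bar>) * (LINT z|lborel. \<bar>\<phi> z\<bar>)"

lemma mass_nonneg: "mass \<ge> 0"
  unfolding mass_def by (intro mult_nonneg_nonneg sum_nonneg integral_nonneg_AE) auto

lemma rescale_test: "\<epsilon> > 0 \<Longrightarrow> i < r \<Longrightarrow> rescale \<phi> x (l i * \<epsilon>) \<in> test_functions"
  using l_pos[of i] by (intro test_functions_rescale test) auto

lemma kernel_test: "\<epsilon> > 0 \<Longrightarrow> kernel \<epsilon> \<in> test_functions"
  unfolding kernel_def by (intro test_functions_sum rescale_test) auto

lemma kernel_support:
  assumes "\<epsilon> > 0" "kernel \<epsilon> w \<noteq> 0"
  shows "norm w \<le> \<epsilon> / 8"
proof -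
  obtain i where "i \<in> {..<r}" "c i * rescale \<phi> 0 (l i * \<epsilon>) w \<noteq> 0"
    using assms(2) unfolding kernel_def by (rule sum.not_neutral_contains_not_neutral)
  then have i: "i < r" and nz: "\<phi> (inverse (l i * \<epsilon>) *\<^sub>R w) \<noteq> 0"
    by (auto simp: rescale_def)
  from small[OF i nz] show ?thesis
    using l_pos[OF i] assms(1) by (simp add: field_simps)
qed

lemma integral_abs_kernel_le:
  assumes "\<epsilon> > 0"
  shows "(LINT w|lborel. \<bar>kernel \<epsilon> w\<bar>) \<le> mass"
proof -
  have int: "integrable lborel (\<lambda>w. \<bar>c i\<bar> * \<bar>rescale \<phi> 0 (l i * \<epsilon>) w\<bar>)" if "i \<in> {..<r}" for i
    using that assms
    by (intro integrable_mult_right integrable_abs test_functions_integrable rescale_test) auto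
  have "(LINT w|lborel. \<bar>kernel \<epsilon> w\<bar>) \<le> (LINT w|lborel. (\<Sum>i<r. \<bar>c i\<bar> * \<bar>rescale \<phi> 0 (l i * \<epsilon>) w\<bar>))"
    by (rule integral_mono'[OF Bochner_Integration.integrable_sum[OF int]])
      (auto simp: kernel_def abs_mult intro!: order_trans[OF sum_abs] sum_nonneg)
  also have "\<dots> = (\<Sum>i<r. LINT w|lborel. \<bar>c i\<bar> * \<bar>rescale \<phi> 0 (l i * \<epsilon>) w\<bar>)"
    by (rule Bochner_Integration.integral_sum[OF int])
  also have "\<dots> = mass"
    unfolding mass_def sum_distrib_right
    using l_pos assms by (intro sum.cong) (auto simp: integral_abs_rescale[OF test])
  finally show ?thesis .
qed

lemma conv_kernel_abs_le:
  assumes "\<epsilon> > 0" "f \<in> test_functions" "\<And>z. \<bar>f z\<bar> \<le> M"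
  shows "\<bar>conv (kernel \<epsilon>) f z\<bar> \<le> mass * M"
proof -
  have "M \<ge> 0"
    using assms(3)[of 0] by linarith
  then have "(LINT w|lborel. \<bar>kernel \<epsilon> w\<bar>) * M \<le> mass * M"
    by (intro mult_right_mono integral_abs_kernel_le assms)
  with conv_abs_le[OF kernel_test[OF assms(1)] assms(2,3), of z] show ?thesis
    by linarith
qed

lemma conv_kernel_support:
  assumes "\<epsilon> > 0" "\<And>z. f z \<noteq> 0 \<Longrightarrow> z \<in> cball x \<rho>" "conv (kernel \<epsilon>) f z \<noteq> 0"
  shows "z \<in> cball x (\<rho> + \<epsilon> / 8)"
proof -
  from assms(3) obtain w where w: "kernel \<epsilon> w \<noteq> 0" "f (z - w) \<noteq> 0"
    by (rule conv_support)
  have "dist x z \<le> dist x (z - w) + dist (z - w) z"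
    by (rule dist_triangle)
  also have "dist (z - w) z = norm w"
    by (simp add: dist_norm)
  finally show ?thesis
    using kernel_support[OF assms(1) w(1)] assms(2)[OF w(2)] by simp
qed

text \<open>
  The Taylor polynomials of \<open>t \<mapsto> f (z - t h)\<close> at the nodes cancel, except for the constant
  term, by the moment conditions; only the remainders are left. Working on each line through \<open>z\<close>
  separately avoids polynomials in several variables.
\<close>

lemma combination_minus_value_le:
  assumes f: "f \<in> test_functions" and M: "\<And>js x. length js = r \<Longrightarrow> \<bar>pders js f x\<bar> \<le> M"
    and \<eta>: "\<eta> > 0" and h: "\<phi> h \<noteq> 0"
  shows "\<bar>(\<Sum>i<r. c i * f (z - (l i * \<eta>) *\<^sub>R h)) - (\<Sum>i<r. c i) * f z\<bar>
    \<le> (\<Sum>i<r. \<bar>c i\<bar>) * (M * (real CARD('n) * \<eta> / 8) ^ r / fact r)"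
proof -
  define p where "p m = (dir_deriv h ^^ m) f z / fact m" for m
  \<comment> \<open>Any list of \<open>r\<close> directions shows that the bound \<open>M\<close> is nonnegative.\<close>
  have "0 \<le> \<bar>pders (replicate r undefined) f 0\<bar>" by simp
  also have "\<dots> \<le> M" by (rule M) simp
  finally have M0: "M \<ge> 0" .
  have I: "(LINT z|lborel. \<phi> z) \<noteq> 0"
    using moments[OF r_pos] by auto
  have pow: "(- (l i * \<eta>)) ^ m = (- \<eta>) ^ m * l i ^ m" for i m
    using power_mult_distrib[of "- \<eta>" "l i" m] by (simp add: mult.commute)
  have "(\<Sum>i<r. c i * (\<Sum>m<r. p m * (- (l i * \<eta>)) ^ m)) = (\<Sum>i<r. \<Sum>m<r. p m * (- \<eta>) ^ m * (c i * l i ^ m))"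
    unfolding pow by (simp add: sum_distrib_left mult_ac)
  also have "\<dots> = (\<Sum>m<r. p m * (- \<eta>) ^ m * (\<Sum>i<r. c i * l i ^ m))"
    by (subst sum.swap) (simp add: sum_distrib_left)
  also have "\<dots> = (\<Sum>m<r. if m = 0 then (\<Sum>i<r. c i) * f z else 0)"
  proof (rule sum.cong[OF refl])
    fix m assume "m \<in> {..<r}"
    then show "p m * (- \<eta>) ^ m * (\<Sum>i<r. c i * l i ^ m) = (if m = 0 then (\<Sum>i<r. c i) * f z else 0)"
      using moments[of m] I by (cases "m = 0") (auto simp: p_def zero_power)
  qed
  also have "\<dots> = (\<Sum>i<r. c i) * f z"
    using r_pos by simp
  finally have poly: "(\<Sum>i<r. c i * (\<Sum>m<r. p m * (- (l i * \<eta>)) ^ m)) = (\<Sum>i<r. c i) * f z" .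
  have "(\<Sum>i<r. c i * f (z - (l i * \<eta>) *\<^sub>R h)) - (\<Sum>i<r. c i) * f z
      = (\<Sum>i<r. c i * (f (z - (l i * \<eta>) *\<^sub>R h) - (\<Sum>m<r. p m * (- (l i * \<eta>)) ^ m)))"
    unfolding poly[symmetric] by (simp add: sum_subtractf right_diff_distrib)
  also have "\<bar>\<dots>\<bar> \<le> (\<Sum>i<r. \<bar>c i\<bar> * (M * (real CARD('n) * \<eta> / 8) ^ r / fact r))"
  proof (rule order_trans[OF sum_abs], rule sum_mono)
    fix i assume "i \<in> {..<r}"
    then have i: "i < r" by simp
    have "l1_norm h * (l i * \<eta>) \<le> (real CARD('n) * norm h) * (l i * \<eta>)"
      using l_pos[OF i] \<eta> by (intro mult_right_mono l1_norm_le) auto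
    also have "\<dots> = real CARD('n) * \<eta> * (l i * norm h)"
      by simp
    also have "\<dots> \<le> real CARD('n) * \<eta> * (1 / 8)"
      using small[OF i h] \<eta> by (intro mult_left_mono) auto
    finally have le: "l1_norm h * \<bar>- (l i * \<eta>)\<bar> \<le> real CARD('n) * \<eta> / 8"
      using l_pos[OF i] \<eta> by simp
    have "\<bar>f (z - (l i * \<eta>) *\<^sub>R h) - (\<Sum>m<r. p m * (- (l i * \<eta>)) ^ m)\<bar>
       \<le> M * (l1_norm h * \<bar>- (l i * \<eta>)\<bar>) ^ r / fact r"
      using Taylor_along_line[OF test_functions_smooth[OF f] M, where r=r and z=z and h=h and t="- (l i * \<eta>)"]
      by (simp add: p_def)
    also have "\<dots> \<le> M * (real CARD('n) * \<eta> / 8) ^ r / fact r"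
      by (intro divide_right_mono mult_left_mono power_mono le M0) auto
    finally show "\<bar>c i * (f (z - (l i * \<eta>) *\<^sub>R h) - (\<Sum>m<r. p m * (- (l i * \<eta>)) ^ m))\<bar>
       \<le> \<bar>c i\<bar> * (M * (real CARD('n) * \<eta> / 8) ^ r / fact r)"
      unfolding abs_mult by (intro mult_left_mono) auto
  qed
  finally show ?thesis
    by (simp only: sum_distrib_right)
qed

text \<open>
  The preceding estimate, integrated against \<open>\<bar>\<phi>\<bar>\<close>.
\<close>

lemma conv_kernel_approx:
  assumes f: "f \<in> test_functions" and M: "\<And>js x. length js = r \<Longrightarrow> \<bar>pders js f x\<bar> \<le> M"
    and \<eta>: "\<eta> > 0"
  shows "\<bar>conv (kernel \<eta>) f z - f z\<bar> \<le> mass * (M * (real CARD('n) * \<eta> / 8) ^ r / fact r)"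
proof -
  let ?E = "M * (real CARD('n) * \<eta> / 8) ^ r / fact r"
  \<comment> \<open>Any list of \<open>r\<close> directions shows that the bound \<open>M\<close> is nonnegative.\<close>
  have "0 \<le> \<bar>pders (replicate r undefined) f 0\<bar>" by simp
  also have "\<dots> \<le> M" by (rule M) simp
  finally have M0: "M \<ge> 0" .
  obtain R where R: "\<And>z. \<phi> z \<noteq> 0 \<Longrightarrow> norm z \<le> R"
    using test_functions_bounded_support[OF test] by blast
  have int: "integrable lborel (\<lambda>h. c i * (\<phi> h * f (z - (l i * \<eta>) *\<^sub>R h)))" for i
    by (intro integrable_mult_right integrable_compact_support[of _ R] continuous_intros
        continuous_on_compose2[OF test_functions_continuous[OF test]]
        continuous_on_compose2[OF test_functions_continuous[OF f]]) (auto intro: R)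
  have int2: "integrable lborel (\<lambda>h. \<phi> h * ((\<Sum>i<r. c i) * f z))"
    by (intro integrable_mult_left test_functions_integrable test)
  have "conv (kernel \<eta>) f z = (\<Sum>i<r. c i * (LINT h|lborel. \<phi> h * f (z - (l i * \<eta>) *\<^sub>R h)))"
    unfolding kernel_def
    by (subst conv_sum_left) (use \<eta> l_pos in \<open>auto simp: conv_rescale[OF test f] intro!: rescale_test f\<close>)
  also have "\<dots> = (LINT h|lborel. (\<Sum>i<r. c i * (\<phi> h * f (z - (l i * \<eta>) *\<^sub>R h))))"
    by (subst Bochner_Integration.integral_sum[OF int]) simp
  finally have 1: "conv (kernel \<eta>) f z = \<dots>" .
  have "f z = (LINT h|lborel. \<phi> h) * ((\<Sum>i<r. c i) * f z)"
    using moments[OF r_pos] by (simp add: mult_ac)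
  also have "\<dots> = (LINT h|lborel. \<phi> h * ((\<Sum>i<r. c i) * f z))"
    by simp
  finally have 2: "f z = \<dots>" .
  have "conv (kernel \<eta>) f z - f z = (LINT h|lborel. (\<Sum>i<r. c i * (\<phi> h * f (z - (l i * \<eta>) *\<^sub>R h))))
      - (LINT h|lborel. \<phi> h * ((\<Sum>i<r. c i) * f z))"
    using 1 2 by simp
  also have "\<dots> = (LINT h|lborel. (\<Sum>i<r. c i * (\<phi> h * f (z - (l i * \<eta>) *\<^sub>R h))) - \<phi> h * ((\<Sum>i<r. c i) * f z))"
    by (rule Bochner_Integration.integral_diff[symmetric])
      (intro Bochner_Integration.integrable_sum int int2)+
  also have "\<bar>\<dots>\<bar> \<le> (LINT h|lborel. \<bar>\<phi> h\<bar> * ((\<Sum>i<r. \<bar>c i\<bar>) * ?E))"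
  proof (rule order_trans[OF integral_abs_bound], rule integral_mono')
    show "integrable lborel (\<lambda>h. \<bar>\<phi> h\<bar> * ((\<Sum>i<r. \<bar>c i\<bar>) * ?E))"
      by (intro integrable_mult_left integrable_abs test_functions_integrable test)
    fix h
    show "0 \<le> \<bar>\<phi> h\<bar> * ((\<Sum>i<r. \<bar>c i\<bar>) * ?E)"
      using M0 \<eta> by (intro mult_nonneg_nonneg sum_nonneg divide_nonneg_nonneg) auto
    have "(\<Sum>i<r. c i * (\<phi> h * f (z - (l i * \<eta>) *\<^sub>R h))) - \<phi> h * ((\<Sum>i<r. c i) * f z)
      = \<phi> h * ((\<Sum>i<r. c i * f (z - (l i * \<eta>) *\<^sub>R h)) - (\<Sum>i<r. c i) * f z)"
      by (simp add: right_diff_distrib sum_distrib_left mult_ac)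
    also have "\<bar>\<dots>\<bar> \<le> \<bar>\<phi> h\<bar> * ((\<Sum>i<r. \<bar>c i\<bar>) * ?E)"
    proof (cases "\<phi> h = 0")
      case False
      then show ?thesis
        unfolding abs_mult by (intro mult_left_mono combination_minus_value_le[OF f M \<eta>]) auto
    qed simp
    finally show "\<bar>(\<Sum>i<r. c i * (\<phi> h * f (z - (l i * \<eta>) *\<^sub>R h))) - \<phi> h * ((\<Sum>i<r. c i) * f z)\<bar>
      \<le> \<bar>\<phi> h\<bar> * ((\<Sum>i<r. \<bar>c i\<bar>) * ?E)" .
  qed
  also have "\<dots> = mass * ?E"
    by (simp add: mass_def)
  finally show ?thesis .
qed

text \<open>
  Convolution commutes with derivatives, so \<open>conv_kernel_approx\<close> applied to each derivative of \<open>g\<close>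
  gives convergence of all derivatives.
\<close>

lemma double_mollification_tendsto:
  fixes T :: "(real ^ 'n \<Rightarrow> real) \<Rightarrow> real"
  assumes T: "T \<in> distributions" and g: "g \<in> test_functions"
    and e: "\<And>n. 0 < e n" "\<And>n. e n \<le> 1" "e \<longlonglongrightarrow> 0"
  shows "(\<lambda>n. T (conv (kernel (2 * e n)) (conv (kernel (e n)) g))) \<longlonglongrightarrow> T g"
proof -
  let ?G = "\<lambda>n. conv (kernel (2 * e n)) (conv (kernel (e n)) g)"
  let ?g = "\<lambda>n z. ?G n z - g z"
  have e2: "2 * e n > 0" for n using e(1)[of n] by simp
  have kt: "conv (kernel (e n)) f \<in> test_functions" if "f \<in> test_functions" for f n
    by (intro test_functions_conv kernel_test e that)
  have Gt: "?G n \<in> test_functions" for n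
    by (intro test_functions_conv kernel_test e e2 g)
  obtain R where R: "\<And>z. g z \<noteq> 0 \<Longrightarrow> norm z \<le> R"
    using test_functions_bounded_support[OF g] by blast
  have "(\<lambda>n. T (?g n)) \<longlonglongrightarrow> 0"
  proof (rule distribution_tendsto_0[OF T])
    let ?K = "cball (0 :: real ^ 'n) (R + 1)"
    show "compact ?K" by simp
    show "?g n \<in> test_functions_in ?K" for n
    proof (rule test_functions_inI)
      show "?g n \<in> test_functions"
        by (intro test_functions_diff Gt g)
      show "closed ?K" by simp
      fix z assume "?g n z \<noteq> 0"
      then consider "g z \<noteq> 0" | "?G n z \<noteq> 0" by fastforce
      then show "z \<in> ?K"
      proof cases
        case 1
        then show ?thesis using R[of z] by simp
      next
        case 2
        have 0: "z \<in> cball 0 R" if "g z \<noteq> 0" for z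
          using R[OF that] by simp
        have "z \<in> cball 0 (R + e n / 8 + 2 * e n / 8)"
          by (rule conv_kernel_support[OF e2 conv_kernel_support[OF e(1) 0] 2])
        then show ?thesis using e(1,2)[of n] by simp
      qed
    qed
    fix js :: "'n list"
    let ?u = "pders js g"
    have u: "?u \<in> test_functions" by (rule test_functions_pders[OF g])
    obtain M where M: "M \<ge> 0" "\<And>js x. length js = r \<Longrightarrow> \<bar>pders js ?u x\<bar> \<le> M"
      using test_functions_pders_bounded[OF u, of r] by blast
    let ?E = "\<lambda>\<eta>. mass * (M * (real CARD('n) * \<eta> / 8) ^ r / fact r)"
    have "\<bar>pders js (?g n) z\<bar> \<le> mass * ?E (e n) + ?E (2 * e n)" for n z
    proof -
      let ?v = "conv (kernel (e n)) ?u"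
      have "pders js (?g n) z = pders js (?G n) z - ?u z"
        using pders_lincomb[OF test_functions_smooth[OF Gt] test_functions_smooth[OF g], of js 1 n "-1"] by simp
      also have "pders js (?G n) z = conv (kernel (2 * e n)) ?v z"
        by (simp add: pders_conv kernel_test e e2 kt g)
      also have "\<dots> - ?u z = conv (kernel (2 * e n)) (\<lambda>z. ?v z - ?u z) z + (conv (kernel (2 * e n)) ?u z - ?u z)"
        by (simp add: conv_diff kernel_test e2 kt u)
      finally have *: "pders js (?g n) z = \<dots>" .
      have "\<bar>conv (kernel (2 * e n)) (\<lambda>z. ?v z - ?u z) z\<bar> \<le> mass * ?E (e n)"
        by (intro conv_kernel_abs_le e2 test_functions_diff kt u conv_kernel_approx M e)
      moreover have "\<bar>conv (kernel (2 * e n)) ?u z - ?u z\<bar> \<le> ?E (2 * e n)"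
        by (intro conv_kernel_approx u M e2)
      ultimately show ?thesis
        unfolding * by linarith
    qed
    moreover have "(\<lambda>n. mass * ?E (e n) + ?E (2 * e n)) \<longlonglongrightarrow> 0"
    proof -
      have "(\<lambda>n. mass * ?E (e n) + ?E (2 * e n)) \<longlonglongrightarrow> mass * ?E 0 + ?E (2 * 0)"
        by (intro tendsto_intros e) simp_all
      moreover have "mass * ?E 0 + ?E (2 * 0) = 0"
        using r_pos by (simp add: zero_power)
      ultimately show ?thesis
        by (simp only:)
    qed
    ultimately show "\<exists>s. s \<longlonglongrightarrow> 0 \<and> (\<forall>n z. \<bar>pders js (?g n) z\<bar> \<le> s n)"
      by blast
  qed
  then have "(\<lambda>n. T (?G n) - T g) \<longlonglongrightarrow> 0"
    by (simp add: distribution_diff[OF T Gt g])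
  then show ?thesis
    by (rule LIM_zero_cancel)
qed

text \<open>
  A translate of \<open>kernel \<epsilon>\<close> is a combination of translates of \<open>\<phi>\<close> at the scales \<open>l i * \<epsilon>\<close>, on which
  \<open>T\<close> is controlled. The price is the weighted sum of the powers \<open>l i powr \<alpha>\<close>.
\<close>

lemma kernel_superposition:
  fixes T :: "(real ^ 'n \<Rightarrow> real) \<Rightarrow> real"
  assumes T: "T \<in> distributions" and S: "S \<ge> 0" and \<epsilon>: "\<epsilon> > 0"
    and hyp: "\<And>y i. y \<in> cball x \<rho> \<Longrightarrow> i < r \<Longrightarrow> 
      \<bar>T (rescale \<phi> y (l i * \<epsilon>))\<bar> \<le> S * (l i * \<epsilon>) powr \<alpha>"
    and u: "u \<in> test_functions" "\<And>z. \<bar>u z\<bar> \<le> m" "\<And>z. u z \<noteq> 0 \<Longrightarrow> z \<in> cball x \<rho>" and \<rho>: "\<rho> \<ge> 0"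
  shows "\<bar>T (conv (kernel \<epsilon>) u)\<bar> \<le> S * (\<Sum>i<r. \<bar>c i\<bar> * l i powr \<alpha>) * \<epsilon> powr \<alpha> * (m * (2 * \<rho>) ^ CARD('n))"
proof -
  let ?A = "S * (\<Sum>i<r. \<bar>c i\<bar> * l i powr \<alpha>) * \<epsilon> powr \<alpha>"
  have A0: "?A \<ge> 0"
    using S by (intro mult_nonneg_nonneg sum_nonneg) auto
  have "\<bar>T (\<lambda>z. kernel \<epsilon> (z - y))\<bar> \<le> ?A" if y: "y \<in> cball x \<rho>" for y
  proof -
    have "(\<lambda>z. kernel \<epsilon> (z - y)) = (\<lambda>z. \<Sum>i<r. c i * rescale \<phi> y (l i * \<epsilon>) z)"
      by (simp add: kernel_def rescale_def)
    then have "T (\<lambda>z. kernel \<epsilon> (z - y)) = (\<Sum>i<r. c i * T (rescale \<phi> y (l i * \<epsilon>)))"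
      using distribution_sum[OF T, of "{..<r}" "\<lambda>i. rescale \<phi> y (l i * \<epsilon>)" c] rescale_test[OF \<epsilon>] by simp
    also have "\<bar>\<dots>\<bar> \<le> (\<Sum>i<r. \<bar>c i\<bar> * (S * (l i * \<epsilon>) powr \<alpha>))"
      by (rule order_trans[OF sum_abs], rule sum_mono)
        (auto simp: abs_mult intro!: mult_left_mono hyp[OF y])
    also have "\<dots> = ?A"
      unfolding sum_distrib_left sum_distrib_right
      using l_pos \<epsilon> by (intro sum.cong) (auto simp: powr_mult less_imp_le)
    finally show ?thesis .
  qed
  from distribution_superposition[OF T u(1) kernel_test[OF \<epsilon>] u(3) this]
  have "\<bar>T (conv u (kernel \<epsilon>))\<bar> \<le> ?A * (LINT y|lborel. \<bar>u y\<bar>)"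
    by simp
  also have "\<dots> \<le> ?A * (m * (2 * \<rho>) ^ CARD('n))"
    by (intro mult_left_mono integral_abs_le_of_support[OF u(1,2,3)] A0 \<rho>)
  finally show ?thesis
    by (simp add: conv_commute[OF u(1) kernel_test[OF \<epsilon>]])
qed

text \<open>
  The telescoping argument. Convolutions at scale \<open>2\<^sup>-\<^sup>n \<le> \<mu>\<close> reach at most \<open>\<mu> / 4\<close> beyond the support
  of \<open>rescale \<psi> x \<mu>\<close>, so \<open>T\<close> is only tested at points within distance \<open>2\<close> of \<open>x\<close>.
\<close>

lemma smeared_test_function_le:
  fixes T :: "(real ^ 'n \<Rightarrow> real) \<Rightarrow> real"
  assumes T: "T \<in> distributions" and S: "S \<ge> 0" and r: "real r > - \<alpha>"
    and hyp: "\<And>y i n. y \<in> cball x 2 \<Longrightarrow> i < r \<Longrightarrow>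
      \<bar>T (rescale \<phi> y (l i / 2 ^ n))\<bar> \<le> S * (l i / 2 ^ n) powr \<alpha>"
    and \<psi>: "\<psi> \<in> test_ball r" and \<mu>: "0 < \<mu>" "\<mu> \<le> 1" and \<alpha>: "\<alpha> \<le> 0"
  shows "\<bar>T (rescale \<psi> x \<mu>)\<bar> \<le>
    S * (\<Sum>i<r. \<bar>c i\<bar> * l i powr \<alpha>) * mass * 4 ^ (CARD('n) + 1) * 2 powr (- \<alpha>)
      / (1 - 2 powr (- \<alpha> - real r)) * \<mu> powr \<alpha>"
proof -
  define g where "g = rescale \<psi> x \<mu>"
  let ?d = "CARD('n)"
  have g: "g \<in> test_functions" and g_supp: "\<And>z. g z \<noteq> 0 \<Longrightarrow> z \<in> cball x \<mu>"
    and g_pders: "\<And>js z. length js \<le> r \<Longrightarrow> \<bar>pders js g z\<bar> \<le> inverse (\<mu> ^ ?d) * inverse \<mu> ^ length js"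
    using test_ball_rescale[OF \<psi> \<mu>(1)] by (auto simp: g_def)
  have g_le: "\<bar>g z\<bar> \<le> inverse (\<mu> ^ ?d)" for z
    using g_pders[of "[]" z] by simp
  define e :: "nat \<Rightarrow> real" where "e n = (1 / 2) ^ n" for n
  have e: "e n > 0" "e n \<le> 1" "2 * e (Suc n) = e n" for n
    by (auto simp: e_def power_le_one)
  have e_lim: "e \<longlonglongrightarrow> 0"
    unfolding e_def by (rule LIMSEQ_power_zero) simp
  define A where "A = S * (\<Sum>i<r. \<bar>c i\<bar> * l i powr \<alpha>)"
  have A0: "A \<ge> 0"
    unfolding A_def using S by (intro mult_nonneg_nonneg sum_nonneg) auto
  define q where "q = (real ?d / 4) ^ r / fact r"
  have q0: "q \<ge> 0" by (simp add: q_def)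
  define \<theta> where "\<theta> = 2 powr (- \<alpha> - real r)"
  have \<theta>: "0 < \<theta>" "\<theta> < 1"
    using r powr_less_mono[of "- \<alpha> - real r" 0 2] by (auto simp: \<theta>_def)
  have smear: "\<bar>T (conv (kernel (e n)) u)\<bar> \<le> A * e n powr \<alpha> * (m * (5 / 2 * \<mu>) ^ ?d)"
    if u: "u \<in> test_functions" "\<And>z. \<bar>u z\<bar> \<le> m" "\<And>z. u z \<noteq> 0 \<Longrightarrow> z \<in> cball x (5 / 4 * \<mu>)" for u m n
  proof -
    have "\<bar>T (rescale \<phi> y (l i * e n))\<bar> \<le> S * (l i * e n) powr \<alpha>"
      if "y \<in> cball x (5 / 4 * \<mu>)" "i < r" for y i
      using hyp[of y i n] that \<mu> by (simp add: e_def power_one_over)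
    from kernel_superposition[OF T S e(1) this u]
    show ?thesis
      using \<mu> by (simp add: A_def)
  qed
  have supp: "z \<in> cball x (5 / 4 * \<mu>)" if "0 < \<eta>" "\<eta> \<le> 2 * \<mu>" "conv (kernel \<eta>) g z \<noteq> 0" for \<eta> z
  proof -
    have "z \<in> cball x (\<mu> + \<eta> / 8)"
      by (rule conv_kernel_support[OF that(1) g_supp that(3)])
    then show ?thesis
      using that(2) by simp
  qed
  define G where "G n = conv (kernel (2 * e n)) (conv (kernel (e n)) g)" for n
  have G_lim: "(\<lambda>n. T (G n)) \<longlonglongrightarrow> T g"
    unfolding G_def by (rule double_mollification_tendsto[OF T g e(1,2) e_lim])
  have ct: "conv (kernel \<eta>) g \<in> test_functions" if "\<eta> > 0" for \<eta>
    by (intro test_functions_conv kernel_test g that)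
  have cancel: "inverse (\<mu> ^ ?d) * (5 / 2 * \<mu>) ^ ?d = (5 / 2) ^ ?d"
    unfolding power_mult_distrib using \<mu> by simp
  define P where "P = A * mass * (5 / 2) ^ ?d"
  have P0: "P \<ge> 0"
    unfolding P_def using A0 mass_nonneg by simp
  have start: "\<bar>T (G n)\<bar> \<le> P * e n powr \<alpha>" if n: "e n \<le> \<mu>" for n
  proof -
    have eq: "G n = conv (kernel (e n)) (conv (kernel (2 * e n)) g)"
      unfolding G_def using e(1)[of n] by (intro conv_left_commute kernel_test g) auto
    have "\<bar>T (G n)\<bar> \<le> A * e n powr \<alpha> * (mass * inverse (\<mu> ^ ?d) * (5 / 2 * \<mu>) ^ ?d)"
      unfolding eq using e(1)[of n] n by (intro smear ct conv_kernel_abs_le g g_le supp) auto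
    also have "\<dots> = P * e n powr \<alpha>"
      using cancel by (simp add: P_def mult_ac)
    finally show ?thesis .
  qed
  have step: "\<bar>T (G (Suc n)) - T (G n)\<bar> \<le> P * (2 * q) * (e n powr \<alpha> * (e n / \<mu>) ^ r)"
    if n: "e n \<le> \<mu>" for n
  proof -
    let ?u1 = "conv (kernel (e n / 2)) g" and ?u2 = "conv (kernel (2 * e n)) g"
    let ?u = "\<lambda>z. ?u1 z - ?u2 z"
    have pos: "e n / 2 > 0" "2 * e n > 0" "e n > 0"
      using e(1)[of n] by auto
    have "G (Suc n) = conv (kernel (e n)) ?u1"
    proof -
      have "e (Suc n) = e n / 2"
        by (simp add: e_def)
      then show ?thesis
        unfolding G_def e(3) by (simp only:)
    qed
    moreover have "G n = conv (kernel (e n)) ?u2"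
      unfolding G_def using pos by (intro conv_left_commute kernel_test g) auto
    ultimately have "T (G (Suc n)) - T (G n) = T (conv (kernel (e n)) ?u)"
      by (simp add: conv_diff[OF kernel_test[OF pos(3)] ct[OF pos(1)] ct[OF pos(2)]] 
          distribution_diff[OF T test_functions_conv[OF kernel_test[OF pos(3)] ct[OF pos(1)]]
            test_functions_conv[OF kernel_test[OF pos(3)] ct[OF pos(2)]]])
    also have "\<bar>\<dots>\<bar> \<le> A * e n powr \<alpha> * (mass * inverse (\<mu> ^ ?d) * (2 * q) * (e n / \<mu>) ^ r * (5 / 2 * \<mu>) ^ ?d)"
    proof (rule smear)
      show "?u \<in> test_functions"
        by (intro test_functions_diff ct pos)
      fix z
      have M: "\<bar>pders js g z\<bar> \<le> inverse (\<mu> ^ ?d) * inverse \<mu> ^ r" if "length js = r" for js z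
        using g_pders[of js z] that by simp
      let ?E = "\<lambda>\<eta>. mass * (inverse (\<mu> ^ ?d) * inverse \<mu> ^ r * (real ?d * \<eta> / 8) ^ r / fact r)"
      have "\<bar>?u1 z - g z\<bar> \<le> ?E (e n / 2)" "\<bar>?u2 z - g z\<bar> \<le> ?E (2 * e n)"
        by (intro conv_kernel_approx g M pos; assumption)+
      moreover have "?E (e n / 2) \<le> ?E (2 * e n)"
        using pos \<mu> mass_nonneg
        by (intro mult_left_mono divide_right_mono power_mono mult_nonneg_nonneg) auto
      moreover have "?E (2 * e n) = mass * inverse (\<mu> ^ ?d) * q * (e n / \<mu>) ^ r"
      proof -
        have 1: "(real ?d * (2 * e n) / 8) ^ r = (real ?d / 4) ^ r * e n ^ r"
          unfolding power_mult_distrib[symmetric] by (simp add: mult.commute)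
        have 2: "(e n / \<mu>) ^ r = e n ^ r * inverse \<mu> ^ r"
          unfolding power_mult_distrib[symmetric] by (simp add: divide_inverse)
        show ?thesis
          unfolding 1 2 q_def by (simp only: divide_inverse mult_ac)
      qed
      ultimately show "\<bar>?u z\<bar> \<le> mass * inverse (\<mu> ^ ?d) * (2 * q) * (e n / \<mu>) ^ r"
        by linarith
    next
      fix z assume "?u z \<noteq> 0"
      then consider "?u1 z \<noteq> 0" | "?u2 z \<noteq> 0" by fastforce
      then show "z \<in> cball x (5 / 4 * \<mu>)"
        using supp[of "e n / 2" z] supp[of "2 * e n" z] pos n by cases auto
    qed
    also have "\<dots> = P * (2 * q) * (e n powr \<alpha> * (e n / \<mu>) ^ r)"
    proof -
      have "mass * inverse (\<mu> ^ ?d) * (2 * q) * (e n / \<mu>) ^ r * (5 / 2 * \<mu>) ^ ?d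
        = mass * (2 * q) * (e n / \<mu>) ^ r * (inverse (\<mu> ^ ?d) * (5 / 2 * \<mu>) ^ ?d)"
        by (simp only: mult_ac)
      also have "\<dots> = mass * (2 * q) * (e n / \<mu>) ^ r * (5 / 2) ^ ?d"
        by (simp only: cancel)
      finally have eq: "mass * inverse (\<mu> ^ ?d) * (2 * q) * (e n / \<mu>) ^ r * (5 / 2 * \<mu>) ^ ?d = \<dots>" .
      show ?thesis
        unfolding eq P_def by (simp only: mult_ac)
    qed
    finally show ?thesis .
  qed
  obtain N where N: "e N \<le> \<mu>" "\<mu> \<le> 2 * e N"
  proof -
    obtain n where "e n < \<mu>"
      using real_arch_pow_inv[of \<mu> "1 / 2"] \<mu> by (auto simp: e_def)
    then have ex: "\<exists>n. e n \<le> \<mu>"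
      by (intro exI[of _ n]) simp
    define N where "N = (LEAST n. e n \<le> \<mu>)"
    have 1: "e N \<le> \<mu>"
      unfolding N_def using ex by (rule LeastI_ex)
    have 2: "\<mu> \<le> 2 * e N"
    proof (cases N)
      case 0
      then show ?thesis using \<mu> by (simp add: e_def)
    next
      case (Suc n)
      then have "\<not> e n \<le> \<mu>"
        unfolding N_def by (metis lessI not_less_Least)
      then show ?thesis
        using Suc e(3)[of n] by simp
    qed
    show ?thesis
      by (rule that[OF 1 2])
  qed
  have mono: "e (N + j) \<le> \<mu>" for j
  proof -
    have "e (N + j) \<le> e N"
      by (simp add: e_def power_add mult_left_le power_le_one)
    with N show ?thesis by simp
  qed
  \<comment> \<open>Starting at a scale between \<open>\<mu> / 2\<close> and \<open>\<mu>\<close> costs the factor \<open>2 powr - \<alpha>\<close>.\<close>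
  define W where "W = 2 powr (- \<alpha>) * \<mu> powr \<alpha>"
  have W0: "W \<ge> 0" by (simp add: W_def)
  have eW: "e N powr \<alpha> \<le> W"
  proof -
    have "e N powr \<alpha> \<le> (\<mu> / 2) powr \<alpha>"
      using N \<mu> \<alpha> by (intro powr_mono2') auto
    also have "\<dots> = W"
      unfolding W_def powr_minus_divide using \<mu> by (simp add: powr_divide)
    finally show ?thesis .
  qed
  have decay: "e (N + j) powr \<alpha> * (e (N + j) / \<mu>) ^ r \<le> W * \<theta> ^ j" for j
  proof -
    have ej: "e j powr \<alpha> * e j ^ r = \<theta> ^ j"
    proof -
      have "e j = 2 powr (- real j)"
        by (simp add: e_def powr_minus powr_realpow power_one_over inverse_eq_divide)
      then have "e j powr (\<alpha> + real r) = \<theta> powr real j"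
        by (simp add: \<theta>_def powr_powr algebra_simps)
      moreover have "e j powr (\<alpha> + real r) = e j powr \<alpha> * e j ^ r"
        by (simp add: powr_add powr_realpow e)
      ultimately show ?thesis
        by (simp add: powr_realpow \<theta>)
    qed
    have "e (N + j) = e N * e j"
      by (simp add: e_def power_add)
    then have "e (N + j) powr \<alpha> * (e (N + j) / \<mu>) ^ r = e N powr \<alpha> * (e N / \<mu>) ^ r * (e j powr \<alpha> * e j ^ r)"
      using e(1)[of N] e(1)[of j] by (simp add: powr_mult power_mult_distrib power_divide)
    also have "\<dots> \<le> W * 1 * \<theta> ^ j"
      unfolding ej using eW N(1) \<mu>(1) e(1)[of N] \<theta> W0
      by (intro mult_mono power_le_one mult_nonneg_nonneg) auto
    finally show ?thesis by simp
  qed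
  have partial: "\<bar>T (G (N + m))\<bar> \<le> P * W + (\<Sum>j<m. P * (2 * q) * (W * \<theta> ^ j))" for m
  proof (induction m)
    case 0
    have "\<bar>T (G N)\<bar> \<le> P * e N powr \<alpha>"
      by (rule start[OF N(1)])
    also have "\<dots> \<le> P * W"
      by (intro mult_left_mono eW P0)
    finally show ?case by simp
  next
    case (Suc m)
    have "\<bar>T (G (Suc (N + m))) - T (G (N + m))\<bar> \<le> P * (2 * q) * (e (N + m) powr \<alpha> * (e (N + m) / \<mu>) ^ r)"
      by (rule step[OF mono])
    also have "\<dots> \<le> P * (2 * q) * (W * \<theta> ^ m)"
      using P0 q0 by (intro mult_left_mono decay) auto
    finally show ?case
      using Suc by simp
  qed
  have total: "\<bar>T (G (N + m))\<bar> \<le> P * W * (1 + 2 * q) / (1 - \<theta>)" for m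
  proof -
    have "(\<Sum>j<m. \<theta> ^ j) = (1 - \<theta> ^ m) / (1 - \<theta>)"
      using \<theta> by (simp add: sum_gp_strict)
    also have "\<dots> \<le> 1 / (1 - \<theta>)"
      using \<theta> by (intro divide_right_mono) auto
    finally have "P * W * (2 * q) * (\<Sum>j<m. \<theta> ^ j) \<le> P * W * (2 * q) * (1 / (1 - \<theta>))"
      using P0 W0 q0 by (intro mult_left_mono) auto
    moreover have "P * W * 1 \<le> P * W * (1 / (1 - \<theta>))"
      using P0 W0 \<theta> by (intro mult_left_mono) auto
    moreover have "(\<Sum>j<m. P * (2 * q) * (W * \<theta> ^ j)) = P * W * (2 * q) * (\<Sum>j<m. \<theta> ^ j)"
      by (simp add: sum_distrib_left mult_ac)
    moreover have "P * W * (1 + 2 * q) / (1 - \<theta>) = P * W * (1 / (1 - \<theta>)) + P * W * (2 * q) * (1 / (1 - \<theta>))"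
      by (simp add: field_simps add_divide_distrib)
    ultimately show ?thesis
      using partial[of m] by linarith
  qed
  have "(\<lambda>m. \<bar>T (G (m + N))\<bar>) \<longlonglongrightarrow> \<bar>T g\<bar>"
    by (intro tendsto_rabs LIMSEQ_ignore_initial_segment G_lim)
  then have "\<bar>T g\<bar> \<le> P * W * (1 + 2 * q) / (1 - \<theta>)"
    by (rule LIMSEQ_le_const2) (use total in \<open>auto simp: add.commute\<close>)
  also have "\<dots> = A * mass * W * ((5 / 2) ^ ?d * (1 + 2 * q)) / (1 - \<theta>)"
    by (simp add: P_def mult_ac)
  also have "\<dots> \<le> A * mass * W * 4 ^ (?d + 1) / (1 - \<theta>)"
    using A0 mass_nonneg W0 \<theta> dimension_constant_le[of ?d r]
    by (intro divide_right_mono mult_left_mono) (auto simp: q_def)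
  also have "\<dots> = S * (\<Sum>i<r. \<bar>c i\<bar> * l i powr \<alpha>) * mass * 4 ^ (?d + 1) * 2 powr (- \<alpha>)
      / (1 - 2 powr (- \<alpha> - real r)) * \<mu> powr \<alpha>"
    by (simp add: A_def W_def \<theta>_def mult_ac)
  finally show ?thesis
    by (simp add: g_def)
qed

end


section \<open>A smooth bump\<close>

text \<open>
  Products of smooth functions are not closed under partial derivatives, but finite sums of products
  are, by the product rule.
\<close>

inductive product_sum :: "(real ^ 'n \<Rightarrow> real) \<Rightarrow> bool" where
  base: "smooth f \<Longrightarrow> smooth g \<Longrightarrow> product_sum (\<lambda>x. f x * g x)"
| add: "product_sum u \<Longrightarrow> product_sum v \<Longrightarrow> product_sum (\<lambda>x. u x + v x)"

lemma smooth_mult: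
  assumes "smooth f" "smooth g"
  shows "smooth (\<lambda>x. f x * g x)"
proof (rule smooth_coinduct[where P=product_sum])
  show "product_sum (\<lambda>x. f x * g x)"
    using assms by (rule product_sum.base)
  have diff: "\<forall>x. u differentiable (at x)" if "product_sum u" for u :: "real ^ 'a \<Rightarrow> real"
    using that by induction (simp_all add: smooth_differentiable)
  then show "u differentiable (at x)" if "product_sum u" for u :: "real ^ 'a \<Rightarrow> real" and x
    using that by blast
  show "product_sum (partial_deriv i u)" if "product_sum u" for u :: "real ^ 'a \<Rightarrow> real" and i
    using that
  proof induction
    case (base f g)
    have "partial_deriv i (\<lambda>x. f x * g x) x = f x * partial_deriv i g x + partial_deriv i f x * g x" for x
      by (subst partial_deriv_eqI[OF has_derivative_mult[OF smooth_has_derivative[OF base(1)] smooth_has_derivative[OF base(2)]]])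
        (simp add: axis_def if_distrib if_distribR cong: if_cong)
    then have "partial_deriv i (\<lambda>x. f x * g x) = (\<lambda>x. f x * partial_deriv i g x + partial_deriv i f x * g x)"
      by blast
    then show ?case
      using base by (simp add: product_sum.intros smooth_partial_deriv)
  next
    case (add u v)
    have "partial_deriv i (\<lambda>x. u x + v x) = (\<lambda>x. partial_deriv i u x + partial_deriv i v x)"
      by (rule ext) (use partial_deriv_lincomb[of u _ v i 1 1] diff[OF add(1)] diff[OF add(2)] in simp)
    then show ?case
      using add by (simp add: product_sum.add)
  qed
qed

lemma smooth_prod:
  assumes "finite F" "\<And>q. q \<in> F \<Longrightarrow> smooth (f q)"
  shows "smooth (\<lambda>x. \<Prod>q\<in>F. f q x)"
  using assms by (induction F rule: finite_induct) (simp_all add: smooth_const smooth_mult)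

lemma smooth_of_coordinate:
  assumes B: "\<And>n t. (B n has_real_derivative B (Suc n) t) (at t)"
  shows "smooth (\<lambda>x. B n (a + c * x $ i))"
proof (rule smooth_coinduct[where P="\<lambda>u. \<exists>n k. u = (\<lambda>x. k * B n (a + c * x $ i))"])
  show "\<exists>n' k. (\<lambda>x. B n (a + c * x $ i)) = (\<lambda>x. k * B n' (a + c * x $ i))"
    by (intro exI[of _ n] exI[of _ 1]) simp
next
  have D: "((\<lambda>x. k * B n (a + c * x $ i)) has_derivative (\<lambda>h. k * (B (Suc n) (a + c * x $ i) * (c * h $ i)))) (at x)"
    for n k and x :: "real ^ 'a"
  proof -
    have "((\<lambda>x. a + c * x $ i) has_derivative (\<lambda>h. c * h $ i)) (at x)"
      by (auto intro!: derivative_eq_intros bounded_linear.has_derivative[OF bounded_linear_vec_nth])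
    from has_derivative_compose[OF this B[unfolded has_field_derivative_def, of n "a + c * x $ i"]]
    show ?thesis
      by (intro has_derivative_mult_right) (simp add: mult_ac)
  qed
  {
    fix u :: "real ^ 'a \<Rightarrow> real" and x
    assume "\<exists>n k. u = (\<lambda>x. k * B n (a + c * x $ i))"
    then show "u differentiable at x"
      using D unfolding differentiable_def by blast
  next
    fix u :: "real ^ 'a \<Rightarrow> real" and j
    assume "\<exists>n k. u = (\<lambda>x. k * B n (a + c * x $ i))"
    then obtain n k where u: "u = (\<lambda>x. k * B n (a + c * x $ i))" by blast
    have "partial_deriv j u x = (k * (c * axis j 1 $ i)) * B (Suc n) (a + c * x $ i)" for x
      unfolding u by (subst partial_deriv_eqI[OF D]) (simp add: mult_ac)
    then show "\<exists>n k. partial_deriv j u = (\<lambda>x. k * B n (a + c * x $ i))"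
      by (intro exI[of _ "Suc n"] exI[of _ "k * (c * axis j 1 $ i)"]) auto
  }
qed

text \<open>
  With \<open>u = 1 / t\<close>, the derivative of \<open>p(u) exp (- u)\<close> in \<open>t\<close> is \<open>u\<^sup>2 (p(u) - p'(u)) exp (- u)\<close>. Hence
  \<open>flat n\<close> below is the \<open>n\<close>-th derivative of the function that is \<open>exp (- 1 / t)\<close> for \<open>t > 0\<close> and
  \<open>0\<close> otherwise.
\<close>

primrec flat_poly :: "nat \<Rightarrow> real poly" where
  "flat_poly 0 = 1"
| "flat_poly (Suc n) = monom 1 2 * (flat_poly n - pderiv (flat_poly n))"

definition flat :: "nat \<Rightarrow> real \<Rightarrow> real" where
  "flat n t = (if t \<le> 0 then 0 else poly (flat_poly n) (1 / t) * exp (- (1 / t)))"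

lemma poly_times_exp_tendsto_0: "((\<lambda>u. poly p u * exp (- u)) \<longlongrightarrow> (0 :: real)) at_top"
proof -
  have "((\<lambda>u. \<Sum>i\<le>degree p. coeff p i * (u ^ i / exp u)) \<longlongrightarrow> (\<Sum>i\<le>degree p. coeff p i * 0)) at_top"
    by (intro tendsto_intros tendsto_power_div_exp_0)
  moreover have "(\<Sum>i\<le>degree p. coeff p i * (u ^ i / exp u)) = poly p u * exp (- u)" for u
    by (simp add: poly_altdef sum_distrib_left exp_minus divide_inverse mult_ac)
  ultimately show ?thesis by simp
qed

lemma DERIV_flat: "(flat n has_real_derivative flat (Suc n) t) (at t)"
proof -
  consider "t < 0" | "t > 0" | "t = 0" by linarith
  then show ?thesis
  proof cases
    case 1
    have "((\<lambda>t. 0) has_real_derivative 0) (at t)" by simp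
    then have "(flat n has_real_derivative 0) (at t)"
      by (rule has_field_derivative_transform_within_open[where S="{..<0}"]) (use 1 in \<open>auto simp: flat_def\<close>)
    then show ?thesis using 1 by (simp add: flat_def)
  next
    case 2
    have "((\<lambda>t. poly (flat_poly n) (1 / t) * exp (- (1 / t))) has_real_derivative
        poly (flat_poly (Suc n)) (1 / t) * exp (- (1 / t))) (at t)"
      using 2
      by (auto intro!: derivative_eq_intros DERIV_chain2[OF poly_DERIV]
          simp: poly_monom power2_eq_square field_simps)
    then have "(flat n has_real_derivative poly (flat_poly (Suc n)) (1 / t) * exp (- (1 / t))) (at t)"
      by (rule has_field_derivative_transform_within_open[where S="{0<..}"]) (use 2 in \<open>auto simp: flat_def\<close>)
    then show ?thesis using 2 by (simp add: flat_def)
  next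
    case 3
    have "((\<lambda>h. flat n h / h) \<longlongrightarrow> 0) (at 0)"
    proof (rule filterlim_split_at)
      have "\<forall>\<^sub>F h in at_left 0. flat n h / h = (0 :: real)"
        by (auto simp: flat_def eventually_at_filter)
      then show "((\<lambda>h. flat n h / h) \<longlongrightarrow> 0) (at_left 0)"
        by (rule tendsto_eventually)
      have "((\<lambda>h. poly (pCons 0 (flat_poly n)) (inverse h) * exp (- (inverse h))) \<longlongrightarrow> 0) (at_right 0)"
        by (rule filterlim_compose[OF poly_times_exp_tendsto_0 filterlim_inverse_at_top_right])
      moreover have "\<forall>\<^sub>F h in at_right 0.
          poly (pCons 0 (flat_poly n)) (inverse h) * exp (- (inverse h)) = flat n h / h"
        by (auto simp: flat_def eventually_at_filter divide_inverse mult_ac)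
      ultimately show "((\<lambda>h. flat n h / h) \<longlongrightarrow> 0) (at_right 0)"
        by (rule Lim_transform_eventually)
    qed
    then show ?thesis
      unfolding 3 by (simp add: DERIV_def flat_def)
  qed
qed

text \<open>
  A product of one-dimensional bumps supported in \<open>[-1/d, 1/d]\<close>; the width makes the \<open>l\<^sup>1\<close> norm, and
  hence the Euclidean norm, at most \<open>1\<close> on the support.
\<close>

lemma bump_exists:
  obtains \<phi> :: "real ^ 'n::finite \<Rightarrow> real"
  where "\<phi> \<in> test_functions_in (cball 0 1)" "(LINT z|lborel. \<phi> z) > 0"
proof -
  define a where "a = 1 / real CARD('n)"
  have a: "a > 0" by (simp add: a_def)
  define \<phi> where "\<phi> = (\<lambda>x :: real ^ 'n. \<Prod>i\<in>UNIV. flat 0 (a + 1 * x $ i) * flat 0 (a + (-1) * x $ i))"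
  have smooth: "smooth \<phi>"
    unfolding \<phi>_def by (intro smooth_prod smooth_mult smooth_of_coordinate DERIV_flat) auto
  have supp: "norm x \<le> 1" if "\<phi> x \<noteq> 0" for x
  proof -
    have "\<bar>x $ i\<bar> \<le> a" for i
    proof -
      have "flat 0 (a + 1 * x $ i) * flat 0 (a + (-1) * x $ i) \<noteq> 0"
        using that unfolding \<phi>_def by (subst (asm) prod_zero_iff) auto
      then show ?thesis
        by (auto simp: flat_def split: if_splits)
    qed
    then have "l1_norm x \<le> (\<Sum>i\<in>(UNIV :: 'n set). a)"
      unfolding l1_norm_def by (intro sum_mono)
    then show ?thesis
      using norm_le_l1_cart[of x] by (simp add: l1_norm_def a_def)
  qed
  have test: "\<phi> \<in> test_functions"
    by (rule test_functionsI[OF smooth supp])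
  then have "\<phi> \<in> test_functions_in (cball 0 1)"
    using supp by (auto intro!: test_functions_inI)
  moreover have "(LINT z|lborel. \<phi> z) > 0"
  proof -
    have nonneg: "\<phi> z \<ge> 0" for z
      unfolding \<phi>_def by (intro prod_nonneg) (auto simp: flat_def)
    have "\<phi> 0 \<noteq> 0"
      using a by (simp add: \<phi>_def flat_def)
    have "(LINT z|lborel. \<phi> z) \<noteq> 0"
    proof
      assume "(LINT z|lborel. \<phi> z) = 0"
      then have "AE z in lborel. \<phi> z = 0"
        using integral_nonneg_eq_0_iff_AE[OF test_functions_integrable[OF test]] nonneg by simp
      moreover have op: "open {z. \<phi> z \<noteq> 0}"
        by (intro open_Collect_neq test_functions_continuous test continuous_on_const)
      ultimately have "{z. \<phi> z \<noteq> 0} \<in> null_sets lborel"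
        by (subst AE_iff_null_sets) auto
      then have "negligible {z. \<phi> z \<noteq> 0}"
        unfolding negligible_iff_null_sets by (rule null_sets_completionI)
      then have "{z. \<phi> z \<noteq> 0} = {}"
        using open_not_negligible[OF op] by blast
      with \<open>\<phi> 0 \<noteq> 0\<close> show False by blast
    qed
    moreover have "(LINT z|lborel. \<phi> z) \<ge> 0"
      using nonneg by simp
    ultimately show ?thesis by linarith
  qed
  ultimately show ?thesis by (rule that)
qed

lemma test_ball_contains_bump:
  obtains \<phi> :: "real ^ 'n::finite \<Rightarrow> real"
  where "\<phi> \<in> test_ball r" "(LINT z|lborel. \<phi> z) \<noteq> 0"
proof -
  obtain \<phi> :: "real ^ 'n \<Rightarrow> real" where \<phi>: "\<phi> \<in> test_functions_in (cball 0 1)" "(LINT z|lborel. \<phi> z) > 0"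
    by (rule bump_exists)
  then have t: "\<phi> \<in> test_functions" and s: "supp \<phi> \<subseteq> cball 0 1"
    by (auto simp: test_functions_in_def)
  define k where "k = inverse (1 + \<bar>Cr_norm r \<phi>\<bar>)"
  have k: "k > 0" by (simp add: k_def)
  let ?\<psi> = "\<lambda>z. k * \<phi> z"
  have "z \<in> cball 0 1" if "\<phi> z \<noteq> 0" for z
    using s supp_memI[of \<phi> z] that by blast
  then have "?\<psi> \<in> test_functions_in (cball 0 1)"
    by (intro test_functions_inI test_functions_scale t) auto
  moreover have "Cr_norm r ?\<psi> \<le> 1"
  proof (rule Cr_norm_le)
    fix js :: "'n list" and x assume "length js \<le> r"
    then have "\<bar>pders js \<phi> x\<bar> \<le> 1 + \<bar>Cr_norm r \<phi>\<bar>"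
      using abs_pders_le_Cr_norm[OF t, of js r x] by linarith
    then have "k * \<bar>pders js \<phi> x\<bar> \<le> 1"
      unfolding k_def by (simp add: field_simps)
    moreover have "pders js ?\<psi> = (\<lambda>x. k * pders js \<phi> x)"
      using pders_affine[OF test_functions_smooth[OF t], of js k 1 0] by simp
    ultimately show "\<bar>pders js ?\<psi> x\<bar> \<le> 1"
      using k by (simp add: abs_mult)
  qed
  ultimately have "?\<psi> \<in> test_ball r"
    by (simp add: test_ball_def)
  moreover have "(LINT z|lborel. ?\<psi> z) \<noteq> 0"
    using k \<phi>(2) by simp
  ultimately show ?thesis by (rule that)
qed

section \<open>Negative Hoelder spaces and a single test function\<close>

lemma dyadic_reproducing_combination:
  assumes "\<phi> \<in> test_functions" "(LINT z|lborel. \<phi> z) \<noteq> 0" "r > 0" "s > 0"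
    and "\<And>z. \<phi> z \<noteq> 0 \<Longrightarrow> s * norm z \<le> 1 / 8"
  shows "reproducing_combination \<phi>
    (\<lambda>i. extrapolation_weight r (\<lambda>i. s / 2 ^ i) i / (LINT z|lborel. \<phi> z)) (\<lambda>i. s / 2 ^ i) r"
proof
  fix m assume "m < r"
  have "inj_on (\<lambda>i. s / 2 ^ i) {..<r}"
    using \<open>s > 0\<close> by (auto simp: inj_on_def)
  from extrapolation_weight_sum[OF this \<open>m < r\<close>]
  show "(\<Sum>i<r. extrapolation_weight r (\<lambda>i. s / 2 ^ i) i / (LINT z|lborel. \<phi> z) * (s / 2 ^ i) ^ m)
      * (LINT z|lborel. \<phi> z) = 0 ^ m"
    using assms(2) by (simp add: sum_distrib_right)
next
  fix i z assume "\<phi> z \<noteq> 0"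
  have "s / 2 ^ i \<le> s / 1"
    using \<open>s > 0\<close> by (intro divide_left_mono) auto
  then have "s / 2 ^ i * norm z \<le> s * norm z"
    by (intro mult_right_mono) auto
  with assms(5)[OF \<open>\<phi> z \<noteq> 0\<close>] show "s / 2 ^ i * norm z \<le> 1 / 8"
    by linarith
qed (use assms in auto)

text \<open>
  The scale \<open>s\<close> of the largest node is left free because it is chosen differently in the two uses: a
  power of \<open>2\<close> when \<open>T\<close> is controlled at dyadic scales only, and a value depending on the support of
  \<open>\<phi>\<close> for the explicit constant.
\<close>

lemma dyadic_bound_extends:
  fixes T :: "(real ^ 'n::finite \<Rightarrow> real) \<Rightarrow> real"
  assumes T: "T \<in> distributions" and \<phi>: "\<phi> \<in> test_functions" "(LINT z|lborel. \<phi> z) \<noteq> 0"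
    and r: "real r > - \<alpha>" and \<alpha>: "\<alpha> \<le> 0" and s: "s > 0" "\<And>z. \<phi> z \<noteq> 0 \<Longrightarrow> s * norm z \<le> 1 / 8"
    and S: "S \<ge> 0" and hyp: "\<And>y n. y \<in> cball x 2 \<Longrightarrow>
      \<bar>T (rescale \<phi> y (s / 2 ^ n))\<bar> \<le> S * (s / 2 ^ n) powr \<alpha>"
    and \<psi>: "\<psi> \<in> test_ball r" and \<mu>: "0 < \<mu>" "\<mu> \<le> 1"
  shows "\<bar>T (rescale \<psi> x \<mu>)\<bar> \<le>
    4 ^ (CARD('n) + 1) * exp 4 * 2 powr (- \<alpha> * real r) * (real r)\<^sup>2 * s powr \<alpha>
      / (1 - 2 powr (- \<alpha> - real r))
      * ((LINT z|lborel. \<bar>\<phi> z\<bar>) / \<bar>LINT z|lborel. \<phi> z\<bar>\<^sup>2) * S * \<mu> powr \<alpha>"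
proof -
  have r0: "r > 0" using r \<alpha> by (cases r) auto
  define c where "c i = extrapolation_weight r (\<lambda>i. s / 2 ^ i) i / (LINT z|lborel. \<phi> z)" for i
  define l where "l i = s / 2 ^ i" for i :: nat
  let ?I = "\<bar>LINT z|lborel. \<phi> z\<bar>" and ?N = "LINT z|lborel. \<bar>\<phi> z\<bar>"
  interpret reproducing_combination \<phi> c l r
    using dyadic_reproducing_combination[OF \<phi> r0 s] by (simp add: c_def[abs_def] l_def[abs_def])
  have I: "?I > 0" using \<phi>(2) by simp
  have N0: "?N \<ge> 0" by simp
  define \<theta> where "\<theta> = 2 powr (- \<alpha> - real r)"
  have \<theta>: "0 < \<theta>" "\<theta> < 1"
    using r powr_less_mono[of "- \<alpha> - real r" 0 2] by (auto simp: \<theta>_def)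
  have c: "\<bar>c i\<bar> \<le> exp 2 / ?I" for i
    unfolding c_def abs_divide using abs_extrapolation_weight_le[OF s(1)] I by (intro divide_right_mono) auto
  have "(\<Sum>i<r. \<bar>c i\<bar>) \<le> real r * (exp 2 / ?I)"
    using sum_bounded_above[of "{..<r}" "\<lambda>i. \<bar>c i\<bar>" "exp 2 / ?I"] c by simp
  then have m: "mass \<le> real r * (exp 2 / ?I) * ?N"
    unfolding mass_def by (intro mult_right_mono N0)
  \<comment> \<open>The largest value of \<open>l i powr \<alpha>\<close>, attained at the last node \<open>i = r - 1\<close>.\<close>
  define L where "L = 2 powr (- \<alpha> * real (r - 1)) * s powr \<alpha>"
  have "\<bar>c i\<bar> * l i powr \<alpha> \<le> exp 2 / ?I * L" if "i < r" for i
  proof -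
    have "l i powr \<alpha> = s powr \<alpha> / (2 powr real i) powr \<alpha>"
      using s(1) by (simp add: l_def powr_divide powr_realpow)
    also have "\<dots> = 2 powr (- \<alpha> * real i) * s powr \<alpha>"
      by (simp add: powr_powr powr_minus_divide mult.commute)
    also have "\<dots> \<le> L"
      unfolding L_def using that \<alpha> by (intro mult_right_mono powr_mono mult_left_mono) auto
    finally show ?thesis
      by (intro mult_mono c) (use I in auto)
  qed
  then have w: "(\<Sum>i<r. \<bar>c i\<bar> * l i powr \<alpha>) \<le> real r * (exp 2 / ?I * L)"
    using sum_bounded_above[of "{..<r}" "\<lambda>i. \<bar>c i\<bar> * l i powr \<alpha>" "exp 2 / ?I * L"] by simp
  have "\<bar>T (rescale \<psi> x \<mu>)\<bar> \<le> S * (\<Sum>i<r. \<bar>c i\<bar> * l i powr \<alpha>) * mass * 4 ^ (CARD('n) + 1) * 2 powr (- \<alpha>)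
      / (1 - 2 powr (- \<alpha> - real r)) * \<mu> powr \<alpha>"
  proof (rule smeared_test_function_le[OF T S r _ \<psi> \<mu> \<alpha>])
    fix y i n assume "y \<in> cball x 2"
    then show "\<bar>T (rescale \<phi> y (l i / 2 ^ n))\<bar> \<le> S * (l i / 2 ^ n) powr \<alpha>"
      using hyp[of y "i + n"] by (simp add: l_def power_add)
  qed
  also have "\<dots> \<le> S * (real r * (exp 2 / ?I * L)) * (real r * (exp 2 / ?I) * ?N) * 4 ^ (CARD('n) + 1) * 2 powr (- \<alpha>)
      / (1 - 2 powr (- \<alpha> - real r)) * \<mu> powr \<alpha>"
    using \<theta> S I mass_nonneg
    by (intro mult_right_mono divide_right_mono mult_mono m w mult_left_mono mult_nonneg_nonneg sum_nonneg)
      (auto simp: \<theta>_def L_def)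
  also have "\<dots> = 4 ^ (CARD('n) + 1) * (exp 2 * exp 2) * (2 powr (- \<alpha> * real (r - 1)) * 2 powr (- \<alpha>)) * (real r)\<^sup>2 * s powr \<alpha>
      / (1 - 2 powr (- \<alpha> - real r)) * (?N / ?I\<^sup>2) * S * \<mu> powr \<alpha>"
    by (simp only: L_def power2_eq_square divide_inverse inverse_mult_distrib mult_ac)
  also have "exp 2 * exp 2 = exp (4 :: real)"
    by (simp flip: exp_add)
  also have "2 powr (- \<alpha> * real (r - 1)) * 2 powr (- \<alpha>) = 2 powr (- \<alpha> * real r)"
    using r0 by (simp add: of_nat_diff algebra_simps flip: powr_add)
  finally show ?thesis .
qed

lemma r_index: "1 \<le> r_index \<alpha>" "real (r_index \<alpha>) > - \<alpha>"
proof -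
  obtain n :: nat where n: "- \<alpha> < real n"
    using reals_Archimedean2 by blast
  have "1 \<le> r_index \<alpha> \<and> real (r_index \<alpha>) > - \<alpha>"
    unfolding r_index_def by (rule LeastI[of _ "Suc n"]) (use n in auto)
  then show "1 \<le> r_index \<alpha>" "real (r_index \<alpha>) > - \<alpha>"
    by auto
qed

lemma enlarge_eq: "enlarge K R = (\<Union>x\<in>K. cball x R)"
proof -
  have "y \<in> cball x R \<Longrightarrow> \<exists>v. y = x + v \<and> norm v \<le> R" for x y :: "real ^ 'a"
    by (intro exI[of _ "y - x"]) (simp add: dist_norm norm_minus_commute)
  then show ?thesis
    unfolding enlarge_def by (fastforce simp: dist_norm)
qed

lemma compact_enlarge: "compact K \<Longrightarrow> compact (enlarge K R)"
  unfolding enlarge_def by (rule compact_sums) auto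

lemma Hoelder_bound_of_single_test_function:
  fixes T :: "(real ^ 'n::finite \<Rightarrow> real) \<Rightarrow> real"
  assumes T: "T \<in> distributions" and \<alpha>: "\<alpha> \<le> 0"
    and \<phi>: "\<phi> \<in> test_functions" "(LINT z|lborel. \<phi> z) \<noteq> 0" "supp \<phi> \<subseteq> cball 0 R"
  shows "Hoelder_seminorm \<alpha> K T
      \<le> ennreal (frakb \<phi> R \<alpha> (r_index \<alpha>)) *
        (SUP x\<in>enlarge K 2. SUP \<epsilon>\<in>{0<..1}. ennreal (\<bar>T (rescale \<phi> x \<epsilon>)\<bar> / \<epsilon> powr \<alpha>))"
    (is "_ \<le> ennreal ?b * ?S")
proof -
  let ?r = "r_index \<alpha>"
  let ?I = "\<bar>LINT z|lborel. \<phi> z\<bar>" and ?N = "LINT z|lborel. \<bar>\<phi> z\<bar>"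
  have I: "?I > 0" using \<phi>(2) by simp
  have "?I \<le> ?N" by (rule integral_abs_bound)
  with I have N: "?N > 0" by linarith
  have R: "R \<ge> 0"
  proof -
    have "\<exists>z. \<phi> z \<noteq> 0"
    proof (rule ccontr)
      assume "\<not> ?thesis"
      then have "\<phi> = (\<lambda>z. 0)" by blast
      with \<phi>(2) show False by simp
    qed
    then obtain z where "\<phi> z \<noteq> 0" by blast
    then have "z \<in> cball 0 R" using \<phi>(3) supp_memI by blast
    then show ?thesis using norm_ge_zero[of z] by (simp del: norm_ge_zero)
  qed
  define \<theta> where "\<theta> = 2 powr (- \<alpha> - real ?r)"
  have \<theta>: "0 < \<theta>" "\<theta> < 1"
    using r_index(2)[of \<alpha>] powr_less_mono[of "- \<alpha> - real ?r" 0 2] by (auto simp: \<theta>_def)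
  \<comment> \<open>Positivity matters when the supremum on the right is infinite, as \<open>0 * top = 0\<close>.\<close>
  have b: "?b > 0"
    unfolding frakb_def using \<theta> I N R r_index(1)[of \<alpha>]
    by (intro mult_pos_pos divide_pos_pos) (auto simp: \<theta>_def)
  show ?thesis
  proof (cases "?S = top")
    case True
    show ?thesis
      unfolding True using b by (simp add: ennreal_mult_top)
  next
    case False
    then obtain S where S: "S \<ge> 0" "?S = ennreal S"
      by (cases ?S) auto
    have hyp: "\<bar>T (rescale \<phi> y \<epsilon>)\<bar> \<le> S * \<epsilon> powr \<alpha>" if "y \<in> enlarge K 2" "0 < \<epsilon>" "\<epsilon> \<le> 1" for y \<epsilon>
    proof -
      have "ennreal (\<bar>T (rescale \<phi> y \<epsilon>)\<bar> / \<epsilon> powr \<alpha>) \<le> ?S"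
        using that by (intro SUP_upper2[of y] SUP_upper2[of \<epsilon>]) auto
      then have "\<bar>T (rescale \<phi> y \<epsilon>)\<bar> / \<epsilon> powr \<alpha> \<le> S"
        using S by (simp add: ennreal_le_iff)
      then show ?thesis
        using that by (simp add: divide_le_eq)
    qed
    \<comment> \<open>Any \<open>s \<le> 1\<close> with \<open>s R \<le> 1/8\<close> is admissible; this one produces the power of \<open>1 + R\<close> in \<open>frakb\<close>.\<close>
    define s where "s = 1 / (8 * (1 + R))"
    have s: "s > 0" "s \<le> 1" using R by (auto simp: s_def)
    have small: "s * norm z \<le> 1 / 8" if "\<phi> z \<noteq> 0" for z
    proof -
      have "norm z \<le> R" using that \<phi>(3) supp_memI[of \<phi> z] by auto
      then show ?thesis using R by (simp add: s_def field_simps)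
    qed
    have bound: "\<bar>T (rescale \<psi> x \<mu>)\<bar> \<le> ?b * S * \<mu> powr \<alpha>"
      if x: "x \<in> K" and \<mu>: "0 < \<mu>" "\<mu> \<le> 1" and \<psi>: "\<psi> \<in> test_ball ?r" for x \<mu> \<psi>
    proof -
      have "\<bar>T (rescale \<phi> y (s / 2 ^ n))\<bar> \<le> S * (s / 2 ^ n) powr \<alpha>" if "y \<in> cball x 2" for y n
      proof (rule hyp)
        show "y \<in> enlarge K 2" using that x by (auto simp: enlarge_eq)
        show "0 < s / 2 ^ n" using s by simp
        have "s \<le> 2 ^ n" using s one_le_power[of "2 :: real" n] by linarith
        then show "s / 2 ^ n \<le> 1" by simp
      qed
      from dyadic_bound_extends[OF T \<phi>(1,2) r_index(2) \<alpha> s(1) small S(1) this \<psi> \<mu>]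
      have "\<bar>T (rescale \<psi> x \<mu>)\<bar> \<le> 4 ^ (CARD('n) + 1) * exp 4 * 2 powr (- \<alpha> * real ?r) * (real ?r)\<^sup>2 * s powr \<alpha>
        / (1 - \<theta>) * (?N / ?I\<^sup>2) * S * \<mu> powr \<alpha>"
        by (simp add: \<theta>_def)
      also have "s powr \<alpha> = 2 powr (- \<alpha> * 3) * (1 + R) powr (- \<alpha>)"
      proof -
        have "s powr \<alpha> = (8 * (1 + R)) powr (- \<alpha>)"
          using R unfolding s_def powr_minus_divide by (subst powr_divide) auto
        also have "\<dots> = (2 powr 3) powr (- \<alpha>) * (1 + R) powr (- \<alpha>)"
          using R powr_mult[of 8 "1 + R" "- \<alpha>"] by simp
        finally show ?thesis by (simp only: powr_powr mult_ac)
      qed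
      also have "4 ^ (CARD('n) + 1) * exp 4 * 2 powr (- \<alpha> * real ?r) * (real ?r)\<^sup>2 * (2 powr (- \<alpha> * 3) * (1 + R) powr (- \<alpha>))
        / (1 - \<theta>) * (?N / ?I\<^sup>2) = (4 ^ (CARD('n) + 1) * (2 powr (- \<alpha> * real ?r) * 2 powr (- \<alpha> * 3))) * (exp 4 * (real ?r)\<^sup>2 
          / (1 - \<theta>) * ((1 + R) powr (- \<alpha>) * ?N / ?I\<^sup>2))"
        by (simp add: divide_inverse mult_ac)
      also have "4 ^ (CARD('n) + 1) * (2 powr (- \<alpha> * real ?r) * 2 powr (- \<alpha> * 3))
         = 4 powr (real CARD('n) - \<alpha> + 1) * 2 powr (- \<alpha> * (real ?r + 1))"
      proof -
        have "4 powr (real CARD('n) - \<alpha> + 1) = (4 :: real) powr real (CARD('n) + 1) * 4 powr (- \<alpha>)"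
          by (simp flip: powr_add add: algebra_simps)
        also have "(4 :: real) powr real (CARD('n) + 1) = 4 ^ (CARD('n) + 1)"
          by (rule powr_realpow) simp
        also have "(4 :: real) powr (- \<alpha>) = 2 powr (- \<alpha> * 2)"
          using powr_powr[of 2 2 "- \<alpha>"] by (simp add: mult.commute)
        finally show ?thesis
          by (simp add: mult.assoc flip: powr_add) (simp add: algebra_simps)
      qed
      also have "4 powr (real CARD('n) - \<alpha> + 1) * 2 powr (- \<alpha> * (real ?r + 1)) * (exp 4 * (real ?r)\<^sup>2 
          / (1 - \<theta>) * ((1 + R) powr (- \<alpha>) * ?N / ?I\<^sup>2)) = ?b"
        by (simp add: frakb_def \<theta>_def divide_inverse mult_ac)
      finally show ?thesis .
    qed
    show ?thesis
      unfolding Hoelder_seminorm_def S(2)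
    proof (intro SUP_least)
      fix x :: "real ^ 'n" and \<mu> :: real and \<psi> :: "real ^ 'n \<Rightarrow> real"
      assume *: "x \<in> K" "\<mu> \<in> {0<..1::real}" "\<psi> \<in> test_ball ?r"
      then have "\<bar>T (rescale \<psi> x \<mu>)\<bar> / \<mu> powr \<alpha> \<le> ?b * S"
        using bound[of x \<mu> \<psi>] by (simp add: divide_le_eq)
      then have "ennreal (\<bar>T (rescale \<psi> x \<mu>)\<bar> / \<mu> powr \<alpha>) \<le> ennreal (?b * S)"
        by (rule ennreal_leI)
      then show "ennreal (\<bar>T (rescale \<psi> x \<mu>)\<bar> / \<mu> powr \<alpha>) \<le> ennreal ?b * ennreal S"
        using b S by (simp add: ennreal_mult)
    qed
  qed
qed

text \<open>
  All scales \<open>s / 2\<^sup>i \<cdot> 2\<^sup>-\<^sup>n\<close> that are used have to be of the form \<open>2\<^sup>-\<^sup>k\<close> with \<open>k \<ge> 1\<close>, so \<open>s\<close> is a small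
  power of \<open>2\<close>.
\<close>

lemma negative_Hoelder_of_single_test_function:
  fixes T :: "(real ^ 'n::finite \<Rightarrow> real) \<Rightarrow> real"
  assumes T: "T \<in> distributions" and \<alpha>: "\<alpha> \<le> 0"
    and \<phi>: "\<phi> \<in> test_functions" "(LINT z|lborel. \<phi> z) \<noteq> 0"
    and hyp: "\<And>K. compact K \<Longrightarrow> \<exists>C. \<forall>x\<in>K. \<forall>\<epsilon>\<in>{2 powr (- real k) | k::nat. k \<ge> 1}.
                 \<bar>T (rescale \<phi> x \<epsilon>)\<bar> \<le> C * \<epsilon> powr \<alpha>"
  shows "T \<in> negative_Hoelder \<alpha>"
  unfolding negative_Hoelder_def
proof (intro CollectI conjI T allI impI)
  fix K :: "(real ^ 'n) set" assume K: "compact K"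
  let ?r = "r_index \<alpha>"
  obtain C where C: "\<forall>x\<in>enlarge K 2. \<forall>\<epsilon>\<in>{2 powr (- real k) | k::nat. k \<ge> 1}.
      \<bar>T (rescale \<phi> x \<epsilon>)\<bar> \<le> C * \<epsilon> powr \<alpha>"
    using hyp[OF compact_enlarge[OF K, of 2]] by blast
  obtain R where R: "\<And>z. \<phi> z \<noteq> 0 \<Longrightarrow> norm z \<le> R"
    using test_functions_bounded_support[OF \<phi>(1)] by blast
  obtain m :: nat where m: "8 * \<bar>R\<bar> < 2 ^ m"
    using real_arch_pow[of 2 "8 * \<bar>R\<bar>"] by auto
  define s where "s = 1 / (2 :: real) ^ Suc m"
  have s: "s > 0" by (simp add: s_def)
  have small: "s * norm z \<le> 1 / 8" if "\<phi> z \<noteq> 0" for z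
    using R[OF that] m by (simp add: s_def field_simps)
  have dyadic: "\<bar>T (rescale \<phi> y (s / 2 ^ n))\<bar> \<le> \<bar>C\<bar> * (s / 2 ^ n) powr \<alpha>" if "y \<in> enlarge K 2" for y n
  proof -
    have "s / 2 ^ n = 2 powr (- real (Suc m + n))"
      unfolding s_def powr_minus_divide by (subst powr_realpow) (simp_all add: power_add)
    then have "s / 2 ^ n \<in> {2 powr (- real k) | k::nat. k \<ge> 1}"
      by (intro CollectI exI[of _ "Suc m + n"]) auto
    with C that have "\<bar>T (rescale \<phi> y (s / 2 ^ n))\<bar> \<le> C * (s / 2 ^ n) powr \<alpha>"
      by blast
    also have "\<dots> \<le> \<bar>C\<bar> * (s / 2 ^ n) powr \<alpha>"
      by (intro mult_right_mono) auto
    finally show ?thesis .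
  qed
  show "\<exists>C. \<forall>x\<in>K. \<forall>\<epsilon>\<in>{0<..1}. \<forall>\<psi>\<in>test_ball ?r. \<bar>T (rescale \<psi> x \<epsilon>)\<bar> \<le> C * \<epsilon> powr \<alpha>"
  proof (intro exI ballI)
    fix x :: "real ^ 'n" and \<epsilon> :: real and \<psi> :: "real ^ 'n \<Rightarrow> real"
    assume x: "x \<in> K" and \<epsilon>: "\<epsilon> \<in> {0<..1::real}" and \<psi>: "\<psi> \<in> test_ball ?r"
    have "\<bar>T (rescale \<phi> y (s / 2 ^ n))\<bar> \<le> \<bar>C\<bar> * (s / 2 ^ n) powr \<alpha>" if "y \<in> cball x 2" for y n
      using that x by (intro dyadic) (auto simp: enlarge_eq)
    then show "\<bar>T (rescale \<psi> x \<epsilon>)\<bar> \<le> (4 ^ (CARD('n) + 1) * exp 4 * 2 powr (- \<alpha> * real ?r) * (real ?r)\<^sup>2 * s powr \<alpha>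
      / (1 - 2 powr (- \<alpha> - real ?r))
      * ((LINT z|lborel. \<bar>\<phi> z\<bar>) / \<bar>LINT z|lborel. \<phi> z\<bar>\<^sup>2) * \<bar>C\<bar>) * \<epsilon> powr \<alpha>"
      using \<epsilon> by (intro dyadic_bound_extends[OF T \<phi> r_index(2) \<alpha> s small _ _ \<psi>]) auto
  qed
qed

theorem theorem12p4:
  fixes T :: "(real ^ 'n::finite \<Rightarrow> real) \<Rightarrow> real" and \<alpha> :: real
  assumes "T \<in> distributions" and "\<alpha> \<le> 0"
  shows
    "(T \<in> negative_Hoelder \<alpha> \<longleftrightarrow>
        (\<exists>r::nat. real r > - \<alpha> \<and>
           (\<forall>K. compact K \<longrightarrow>
              (\<exists>C. \<forall>x\<in>K. \<forall>\<epsilon>\<in>{0<..1}. \<forall>\<psi>\<in>test_ball r.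
                 \<bar>T (rescale \<psi> x \<epsilon>)\<bar> \<le> C * \<epsilon> powr \<alpha>))))
     \<and>
     (T \<in> negative_Hoelder \<alpha> \<longleftrightarrow>
        (\<exists>\<phi>\<in>test_functions. (LINT z|lborel. \<phi> z) \<noteq> 0 \<and>
           (\<forall>K. compact K \<longrightarrow>
              (\<exists>C. \<forall>x\<in>K. \<forall>\<epsilon>\<in>{2 powr (- real k) | k::nat. k \<ge> 1}.
                 \<bar>T (rescale \<phi> x \<epsilon>)\<bar> \<le> C * \<epsilon> powr \<alpha>))))
     \<and>
     (\<forall>K. compact K \<longrightarrow>
        (\<forall>\<phi>\<in>test_functions. \<forall>R. (LINT z|lborel. \<phi> z) \<noteq> 0 \<longrightarrow> supp \<phi> \<subseteq> cball 0 R \<longrightarrow>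
           Hoelder_seminorm \<alpha> K T
             \<le> ennreal (frakb \<phi> R \<alpha> (r_index \<alpha>)) *
               (SUP x\<in>enlarge K 2. SUP \<epsilon>\<in>{0<..1}.
                  ennreal (\<bar>T (rescale \<phi> x \<epsilon>)\<bar> / \<epsilon> powr \<alpha>))))"
    (is "(?one \<longleftrightarrow> ?two) \<and> (?one \<longleftrightarrow> ?three) \<and> ?bound")
proof -
  have 12: ?two if ?one
    using that r_index(2)[of \<alpha>] unfolding negative_Hoelder_def by blast
  have 23: ?three if two: ?two
  proof -
    obtain r where "real r > - \<alpha>" and r: "\<And>K. compact K \<Longrightarrow> \<exists>C. \<forall>x\<in>K. \<forall>\<epsilon>\<in>{0<..1}. \<forall>\<psi>\<in>test_ball r.
        \<bar>T (rescale \<psi> x \<epsilon>)\<bar> \<le> C * \<epsilon> powr \<alpha>"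
      using two by blast
    obtain \<phi> :: "real ^ 'n \<Rightarrow> real" where \<phi>: "\<phi> \<in> test_ball r" "(LINT z|lborel. \<phi> z) \<noteq> 0"
      by (rule test_ball_contains_bump)
    show ?three
    proof (intro bexI[of _ \<phi>] conjI allI impI \<phi>)
      show "\<phi> \<in> test_functions"
        using \<phi>(1) by (simp add: test_ball_def test_functions_in_def)
      fix K :: "(real ^ 'n) set" assume "compact K"
      then obtain C where C: "\<forall>x\<in>K. \<forall>\<epsilon>\<in>{0<..1}. \<forall>\<psi>\<in>test_ball r. \<bar>T (rescale \<psi> x \<epsilon>)\<bar> \<le> C * \<epsilon> powr \<alpha>"
        using r by blast
      have "2 powr (- real k) \<in> {0<..1 :: real}" for k :: nat
        by (simp add: powr_minus powr_realpow inverse_le_1_iff)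
      then show "\<exists>C. \<forall>x\<in>K. \<forall>\<epsilon>\<in>{2 powr (- real k) | k::nat. k \<ge> 1}. \<bar>T (rescale \<phi> x \<epsilon>)\<bar> \<le> C * \<epsilon> powr \<alpha>"
        using C \<phi>(1) by blast
    qed
  qed
  have 31: ?one if three: ?three
  proof -
    obtain \<phi> where "\<phi> \<in> test_functions" "(LINT z|lborel. \<phi> z) \<noteq> 0"
      "\<forall>K. compact K \<longrightarrow> (\<exists>C. \<forall>x\<in>K. \<forall>\<epsilon>\<in>{2 powr (- real k) | k::nat. k \<ge> 1}.
         \<bar>T (rescale \<phi> x \<epsilon>)\<bar> \<le> C * \<epsilon> powr \<alpha>)"
      using three by blast
    then show ?one
      by (intro negative_Hoelder_of_single_test_function[OF assms, of \<phi>]) auto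
  qed
  have ?bound
    by (intro allI ballI impI Hoelder_bound_of_single_test_function[OF assms])
  with 12 23 31 show ?thesis
    by blast
qed

end
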